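(* Let $(m(t),\,t\in\mathbb{R}_+)$ be the solution of Problem 1 with initial condition $m_0$, let $\mu_0$ be the mean of $m_0$, and let $c$ be the number of components of the limiting partial consensus $m(\infty)$. Assume that, for some $n\in\{2,3,\dots\}$, some convex continuous $h:[0,1]\to\mathbb{R}_+$, and some $q\ge0$, we have $q\in Q_n(\mu_0,h)$. Under these assumptions, if $\langle h,m_0\rangle\le q$ then $c\le n-1$.
   Context: Fix $\Delta\in(0,1]$ and $w\in(0,1)$. $\mathcal{P}[0,1]$ is the set of Borel probability measures on $[0,1]$; $\langle h,\mu\rangle=\int h\,d\mu$. Problem 1: a family $(m(t),\,t\in\mathbb{R}_+)$ with $m(t)\in\mathcal{P}[0,1]$ is a solution of Problem 1 with initial value $m_0\in\mathcal{P}[0,1]$ if $m(0)=m_0$ and, for all bounded measurable $g:[0,1]\to\mathbb{R}$ and $t\ge0$, $$\langle g,m(t)\rangle-\langle g,m(0)\rangle=\int_0^t 2\iint[g(wx+(1-w)y)-g(x)]\,1_{\{|x-y|\le\Delta\}}\,m(s)(dy)\,m(s)(dx)\,ds.$$ For each $m_0$ there is exactly one solution. As $t\to\infty$, $m(t)$ converges weakly to some $m(\infty)=\sum_{i=1}^c\alpha_i\delta_{x_i}$ with $x_i\in[0,1]$, $|x_i-x_j|\ge\Delta$ for $i\ne j$, $\alpha_i>0$; $c$ is its number of components. For $n\in\{1,2,3,\dots\}$ and $\mu_0\in[0,1]$, $P_n(\mu_0)$ is the set of partial consensus with $n$ components and mean $\mu_0$: the set of $\nu=\sum_{i=1}^n\alpha_i\delta_{x_i}$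 with $0\le x_1<\dots<x_n\le1$, $x_i+\Delta<x_{i+1}$, $\alpha_i>0$, $\sum_i\alpha_i=1$ and $\sum_i\alpha_ix_i=\mu_0$. For convex continuous $h:[0,1]\to\mathbb{R}_+$, $Q_n(\mu_0,h)$ is the set of $q\in\mathbb{R}_+$ such that $\langle h,\nu\rangle>q$ for every $\nu\in P_n(\mu_0)$; if $P_n(\mu_0)$ is empty, $Q_n(\mu_0,h)=\mathbb{R}_+$. *)

theory Defs
  imports "HOL-Probability.Probability"
begin

definition unit_borel :: "real measure" where
  "unit_borel = restrict_space borel {0..1}"

definition prob_unit :: "real measure set" where
  "prob_unit = {\<mu>. prob_space \<mu> \<and> sets \<mu> = sets unit_borel}"

text \<open>
  Solutions of Problem 1 with initial value \<open>m0\<close>. Only the values of \<open>m\<close> at times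
  \<open>t \<ge> 0\<close> matter. The integral equation is stated with \<open>has_integral\<close>, so that
  integrability of the integrand in time is part of it; as this integrand is bounded, its
  integral over \<open>{0..t}\<close> is the Lebesgue integral.
\<close>
definition is_solution ::
  "real \<Rightarrow> real \<Rightarrow> real measure \<Rightarrow> (real \<Rightarrow> real measure) \<Rightarrow> bool" where
  "is_solution \<Delta> w m0 m \<longleftrightarrow>
     (\<forall>t\<ge>0. m t \<in> prob_unit) \<and> m 0 = m0 \<and>
     (\<forall>(g :: real \<Rightarrow> real) t. g \<in> borel_measurable unit_borel \<longrightarrow> bounded (g ` {0..1}) \<longrightarrow> 0 \<le> t \<longrightarrow>
        ((\<lambda>s. 2 * (\<integral>x. (\<integral>y. (g (w * x + (1 - w) * y) - g x) *
                            indicat_real {y. \<bar>x - y\<bar> \<le> \<Delta>} y \<partial>m s) \<partial>m s))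
          has_integral ((\<integral>x. g x \<partial>m t) - (\<integral>x. g x \<partial>m 0))) {0..t})"

text \<open>Continuous functions on \<open>{0..1}\<close> are automatically bounded.\<close>
definition weak_limit :: "(real \<Rightarrow> real measure) \<Rightarrow> real measure \<Rightarrow> bool" where
  "weak_limit m \<nu> \<longleftrightarrow> \<nu> \<in> prob_unit \<and>
     (\<forall>f :: real \<Rightarrow> real. continuous_on {0..1} f \<longrightarrow>
        ((\<lambda>t. \<integral>x. f x \<partial>m t) \<longlongrightarrow> (\<integral>x. f x \<partial>\<nu>)) at_top)"

text \<open>\<open>\<nu> = (\<Sum>i=1..n. \<alpha> i * \<delta>\<^sub>x\<^sub>i)\<close>, the library having no sum of measures.\<close>
definition is_dirac_sum ::
  "nat \<Rightarrow> (nat \<Rightarrow> real) \<Rightarrow> (nat \<Rightarrow> real) \<Rightarrow> real measure \<Rightarrow> bool" where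
  "is_dirac_sum n \<alpha> x \<nu> \<longleftrightarrow> sets \<nu> = sets unit_borel \<and>
     (\<forall>A\<in>sets unit_borel.
        emeasure \<nu> A = (\<Sum>i=1..n. ennreal (\<alpha> i) * emeasure (return unit_borel (x i)) A))"

text \<open>
  The form of the limits \<open>m(\<infinity>)\<close>, with \<open>c\<close> components. Their separation is \<open>\<ge> \<Delta>\<close>, whereas it
  is \<open>> \<Delta>\<close> in \<open>partial_consensus\<close>.
\<close>
definition limit_consensus :: "real \<Rightarrow> nat \<Rightarrow> real measure \<Rightarrow> bool" where
  "limit_consensus \<Delta> c \<nu> \<longleftrightarrow> \<nu> \<in> prob_unit \<and>
     (\<exists>\<alpha> x. (\<forall>i\<in>{1..c}. 0 < \<alpha> i \<and> x i \<in> {0..1}) \<and>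
        (\<forall>i\<in>{1..c}. \<forall>j\<in>{1..c}. i \<noteq> j \<longrightarrow> \<Delta> \<le> \<bar>x i - x j\<bar>) \<and>
        is_dirac_sum c \<alpha> x \<nu>)"

definition partial_consensus :: "real \<Rightarrow> nat \<Rightarrow> real \<Rightarrow> real measure set" where
  "partial_consensus \<Delta> n \<mu>0 =
     {\<nu>. \<exists>\<alpha> x. (\<forall>i\<in>{1..n}. 0 < \<alpha> i \<and> x i \<in> {0..1}) \<and>
          strict_mono_on {1..n} x \<and>
          (\<forall>i\<in>{1..<n}. x i + \<Delta> < x (i + 1)) \<and>
          (\<Sum>i=1..n. \<alpha> i) = 1 \<and>
          (\<Sum>i=1..n. \<alpha> i * x i) = \<mu>0 \<and>
          is_dirac_sum n \<alpha> x \<nu>}"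

definition Q_set :: "real \<Rightarrow> nat \<Rightarrow> real \<Rightarrow> (real \<Rightarrow> real) \<Rightarrow> real set" where
  "Q_set \<Delta> n \<mu>0 h = {q. 0 \<le> q \<and> (\<forall>\<nu>\<in>partial_consensus \<Delta> n \<mu>0. q < (\<integral>x. h x \<partial>\<nu>))}"

end

theory Submission
  imports Defs
begin

text \<open>
  Write \<open>x' = w x + (1 - w) y\<close> and \<open>y' = w y + (1 - w) x\<close> for the opinions of a pair after it has
  interacted. After symmetrisation in the pair, the equation says that \<open>\<langle>g, m(t)\<rangle>\<close> changes at the
  rate \<open>\<integral>\<integral> (g x' + g y' - g x - g y) m(t)(dx) m(t)(dy)\<close>, the integral being over the pairs at distance
  at most \<open>\<Delta>\<close>. For convex \<open>g\<close> this rate is nonpositive. Hence the mean is conserved and \<open>\<langle>h, m(t)\<rangle>\<close>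
  does not increase, so the limit has mean \<open>\<mu>0\<close> and integrates \<open>h\<close> to at most \<open>q\<close>. If it had
  \<open>c \<ge> n\<close> atoms, then merging neighbouring atoms into their barycentres until \<open>n\<close> are left would keep
  the mean and, by convexity, not increase the integral of \<open>h\<close> (\<open>merge_atoms\<close>). The outcome would be a
  partial consensus with \<open>n\<close> components on which \<open>h\<close> integrates to at most \<open>q\<close>, contrary to the choice
  of \<open>q\<close>.

  This argument needs atoms that are more than \<open>\<Delta>\<close> apart, whereas those of the limit are known only
  to be at least \<open>\<Delta>\<close> apart. Most of the proof excludes the distance \<open>\<Delta>\<close>
  (\<open>limit_atoms_strictly_separated\<close>). Suppose that the limit has atoms at \<open>p\<close> and \<open>p + \<Delta>\<close>, so that at
  late times almost all the mass near \<open>[p, p + \<Delta>]\<close> forms two clusters near these points. Call dust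
  the mass well inside \<open>(p, p + \<Delta>)\<close>. Dust is within distance \<open>\<Delta>\<close> of both clusters, and an interaction
  of a dust particle with a cluster puts both partners strictly between the cluster and the dust
  particle. Measured by a concave quadratic function, the amount of dust therefore never decreases
  (\<open>drift_hump_nonneg\<close>). But it tends to zero, so from some time on there is no dust.

  Without dust, the atom at \<open>p\<close> cannot be approached from outside alone: at all late times there must
  be mass in \<open>[p, p + r]\<close>, and in the same way mass in \<open>[p + \<Delta> - r, p + \<Delta>]\<close>
  (\<open>charged_inner_side\<close>). These masses are within distance \<open>\<Delta>\<close> of each other, so they interact and
  produce dust, a contradiction.
\<close>

section \<open>The equation in symmetrised form\<close>
definition observable :: "(real \<Rightarrow> real) \<Rightarrow> bool" where
  "observable g \<longleftrightarrow> g \<in> borel_measurable unit_borel \<and> bounded (g ` {0..1})"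

lemma space_unit_borel [simp]: "space unit_borel = {0..1}"
  by (simp add: unit_borel_def space_restrict_space)

lemma unit_interval_sets: "{0..1} \<in> sets unit_borel"
  by (metis sets.top space_unit_borel)

lemma measurable_unit_borelI: "g \<in> borel_measurable borel \<Longrightarrow> g \<in> borel_measurable unit_borel"
  unfolding unit_borel_def by (rule measurable_restrict_space1)

lemma observable_continuous: "continuous_on {0..1} g \<Longrightarrow> observable g"
  unfolding observable_def unit_borel_def
  by (auto intro: borel_measurable_continuous_on_restrict compact_imp_bounded compact_continuous_image)

lemma observable_bounded_measurable:
  assumes "g \<in> borel_measurable borel" and "\<And>x. x \<in> {0..1} \<Longrightarrow> \<bar>g x\<bar> \<le> B"
  shows "observable g"
  unfolding observable_def bounded_iff using assms by (fastforce intro: measurable_unit_borelI)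

lemma observable_boundE:
  assumes "observable g"
  obtains B where "\<And>x. x \<in> {0..1} \<Longrightarrow> \<bar>g x\<bar> \<le> B"
  using assms unfolding observable_def bounded_iff by force

lemma
  assumes "\<mu> \<in> prob_unit"
  shows prob_unit_prob_space: "prob_space \<mu>"
    and prob_unit_sets: "sets \<mu> = sets unit_borel"
    and prob_unit_space: "space \<mu> = {0..1}"
    and prob_unit_measurable: "(g \<in> borel_measurable \<mu>) = (g \<in> borel_measurable unit_borel)"
proof -
  show "prob_space \<mu>" and s: "sets \<mu> = sets unit_borel"
    using assms by (auto simp: prob_unit_def)
  show "space \<mu> = {0..1}"
    using sets_eq_imp_space_eq[OF s] by simp
  show "(g \<in> borel_measurable \<mu>) = (g \<in> borel_measurable unit_borel)"
    using measurable_cong_sets[OF s refl] by blast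
qed

lemma prob_unit_pair_prob_space:
  assumes "\<mu> \<in> prob_unit"
  shows "pair_prob_space \<mu> \<mu>"
proof -
  interpret prob_space \<mu> by (rule prob_unit_prob_space[OF assms])
  show ?thesis by unfold_locales
qed

lemma prob_unit_pair_sets:
  assumes "\<mu> \<in> prob_unit"
  shows "sets (\<mu> \<Otimes>\<^sub>M \<mu>) = sets (unit_borel \<Otimes>\<^sub>M unit_borel)"
  by (intro sets_pair_measure_cong prob_unit_sets assms)

lemma prob_unit_pair_space:
  assumes "\<mu> \<in> prob_unit"
  shows "space (\<mu> \<Otimes>\<^sub>M \<mu>) = {0..1} \<times> {0..1}"
  by (simp add: space_pair_measure prob_unit_space[OF assms])

lemma integrable_observable:
  assumes "\<mu> \<in> prob_unit" and "observable g"
  shows "integrable \<mu> g"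
proof -
  interpret prob_space \<mu> by (rule prob_unit_prob_space[OF assms(1)])
  obtain B where "\<And>x. x \<in> {0..1} \<Longrightarrow> norm (g x) \<le> B"
    using observable_boundE[OF assms(2)] by (metis real_norm_def)
  then show ?thesis
    using assms by (intro integrable_const_bound[of _ B])
      (auto simp: prob_unit_space[OF assms(1)] prob_unit_measurable[OF assms(1)] observable_def
        intro!: AE_I2)
qed

lemma integrable_pair_bounded:
  assumes "\<mu> \<in> prob_unit" and "F \<in> borel_measurable (unit_borel \<Otimes>\<^sub>M unit_borel)"
    and "\<And>x y. x \<in> {0..1} \<Longrightarrow> y \<in> {0..1} \<Longrightarrow> \<bar>F (x, y)\<bar> \<le> B"
  shows "integrable (\<mu> \<Otimes>\<^sub>M \<mu>) (F :: real \<times> real \<Rightarrow> real)"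
proof -
  interpret pair_prob_space \<mu> \<mu> by (rule prob_unit_pair_prob_space[OF assms(1)])
  have "F \<in> borel_measurable (\<mu> \<Otimes>\<^sub>M \<mu>)"
    using assms(2) measurable_cong_sets[OF prob_unit_pair_sets[OF assms(1)] refl] by blast
  then show ?thesis
    using assms(3) by (intro P.integrable_const_bound[of _ B])
      (auto simp: prob_unit_pair_space[OF assms(1)] intro!: AE_I2)
qed

lemma convex_combination_in_unit:
  fixes w x y :: real
  assumes "0 \<le> w" "w \<le> 1" "x \<in> {0..1}" "y \<in> {0..1}"
  shows "w * x + (1 - w) * y \<in> {0..1}"
  using assms convexD_alt[of "{0..1::real}" y x w] by (simp add: add.commute)

lemma measurable_coordinates:
  "fst \<in> borel_measurable (unit_borel \<Otimes>\<^sub>M unit_borel)"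
  "snd \<in> borel_measurable (unit_borel \<Otimes>\<^sub>M unit_borel)"
proof -
  have id: "(\<lambda>x. x) \<in> borel_measurable unit_borel"
    by (rule measurable_unit_borelI) simp
  show "fst \<in> borel_measurable (unit_borel \<Otimes>\<^sub>M unit_borel)"
    by (rule measurable_compose[OF measurable_fst id])
  show "snd \<in> borel_measurable (unit_borel \<Otimes>\<^sub>M unit_borel)"
    by (rule measurable_compose[OF measurable_snd id])
qed

lemma measurable_jump:
  assumes "0 \<le> w" "w \<le> 1"
  shows "(\<lambda>z. w * fst z + (1 - w) * snd z) \<in> unit_borel \<Otimes>\<^sub>M unit_borel \<rightarrow>\<^sub>M unit_borel"
    and "(\<lambda>z. w * snd z + (1 - w) * fst z) \<in> unit_borel \<Otimes>\<^sub>M unit_borel \<rightarrow>\<^sub>M unit_borel"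
proof -
  note [measurable] = measurable_coordinates
  have ran: "w * fst z + (1 - w) * snd z \<in> {0..1}" "w * snd z + (1 - w) * fst z \<in> {0..1}"
    if "z \<in> space (unit_borel \<Otimes>\<^sub>M unit_borel)" for z
    using that convex_combination_in_unit[OF assms] by (auto simp: space_pair_measure)
  show "(\<lambda>z. w * fst z + (1 - w) * snd z) \<in> unit_borel \<Otimes>\<^sub>M unit_borel \<rightarrow>\<^sub>M unit_borel"
    by (subst (3) unit_borel_def, rule measurable_restrict_space2)
        (use ran in \<open>auto simp del: atLeastAtMost_iff\<close>)
  show "(\<lambda>z. w * snd z + (1 - w) * fst z) \<in> unit_borel \<Otimes>\<^sub>M unit_borel \<rightarrow>\<^sub>M unit_borel"
    by (subst (3) unit_borel_def, rule measurable_restrict_space2)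
        (use ran in \<open>auto simp del: atLeastAtMost_iff\<close>)
qed

lemma measurable_close:
  "(\<lambda>z. indicat_real {y. \<bar>fst z - y\<bar> \<le> \<Delta>} (snd z)) \<in> borel_measurable (unit_borel \<Otimes>\<^sub>M unit_borel)"
proof -
  note [measurable] = measurable_coordinates
  have "(\<lambda>z. indicat_real {y. \<bar>fst z - y\<bar> \<le> \<Delta>} (snd z)) = (\<lambda>z. if \<bar>fst z - snd z\<bar> \<le> \<Delta> then 1 else 0)"
    by (auto simp: indicator_def)
  then show ?thesis by simp
qed

text \<open>
  The integrand of the equation depends on the order of the pair: only its first member jumps.
  Letting both members jump and dropping the factor 2 gives the same integral, and makes convexity
  and conservation laws visible pair by pair.
\<close>
definition gain :: "real \<Rightarrow> real \<Rightarrow> (real \<Rightarrow> real) \<Rightarrow> real \<Rightarrow> real \<Rightarrow> real" where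
  "gain \<Delta> w g x y = (g (w * x + (1 - w) * y) + g (w * y + (1 - w) * x) - g x - g y)
     * indicat_real {y. \<bar>x - y\<bar> \<le> \<Delta>} y"

definition drift :: "real \<Rightarrow> real \<Rightarrow> (real \<Rightarrow> real) \<Rightarrow> real measure \<Rightarrow> real" where
  "drift \<Delta> w g \<mu> = (\<integral>z. gain \<Delta> w g (fst z) (snd z) \<partial>(\<mu> \<Otimes>\<^sub>M \<mu>))"

lemma
  assumes w: "0 \<le> w" "w \<le> 1" and \<mu>: "\<mu> \<in> prob_unit" and g: "observable g"
  shows integrable_gain: "integrable (\<mu> \<Otimes>\<^sub>M \<mu>) (\<lambda>z. gain \<Delta> w g (fst z) (snd z))"
    and drift_eq_collision_integral:
      "2 * (\<integral>x. (\<integral>y. (g (w * x + (1 - w) * y) - g x) * indicat_real {y. \<bar>x - y\<bar> \<le> \<Delta>} y \<partial>\<mu>) \<partial>\<mu>)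
        = drift \<Delta> w g \<mu>"
proof -
  interpret pair_prob_space \<mu> \<mu> by (rule prob_unit_pair_prob_space[OF \<mu>])
  define F where "F z = (g (w * fst z + (1 - w) * snd z) - g (fst z))
      * indicat_real {y. \<bar>fst z - y\<bar> \<le> \<Delta>} (snd z)" for z
  define F' where "F' z = F (snd z, fst z)" for z
  note [measurable] = measurable_close
  from g have g_meas [measurable]: "g \<in> borel_measurable unit_borel" by (simp add: observable_def)
  have F_meas [measurable]: "F \<in> borel_measurable (unit_borel \<Otimes>\<^sub>M unit_borel)"
    unfolding F_def
    using measurable_compose[OF measurable_jump(1)[OF w] g_meas] by measurable
  obtain B where B: "\<And>x. x \<in> {0..1} \<Longrightarrow> \<bar>g x\<bar> \<le> B"
    using observable_boundE[OF g] by metis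
  have F_bound: "\<bar>F (x, y)\<bar> \<le> 2 * B" if "x \<in> {0..1}" "y \<in> {0..1}" for x y
    using B[OF that(1)] B[OF convex_combination_in_unit[OF w that]] by (auto simp: F_def indicator_def)
  have F_int: "integrable (\<mu> \<Otimes>\<^sub>M \<mu>) F"
    by (rule integrable_pair_bounded[OF \<mu> F_meas F_bound])
  have F'_eq: "F' = (\<lambda>(x, y). F (y, x))" by (auto simp: F'_def)
  have F'_int: "integrable (\<mu> \<Otimes>\<^sub>M \<mu>) F'"
    unfolding F'_eq by (rule integrable_product_swap[OF F_int])
  have gain: "gain \<Delta> w g (fst z) (snd z) = F z + F' z" for z
    by (auto simp: gain_def F_def F'_def indicator_def abs_minus_commute)
  show "integrable (\<mu> \<Otimes>\<^sub>M \<mu>) (\<lambda>z. gain \<Delta> w g (fst z) (snd z))"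
    unfolding gain using F_int F'_int by simp
  have "drift \<Delta> w g \<mu> = (\<integral>z. F z \<partial>(\<mu> \<Otimes>\<^sub>M \<mu>)) + (\<integral>z. F' z \<partial>(\<mu> \<Otimes>\<^sub>M \<mu>))"
    unfolding drift_def gain using F_int F'_int by simp
  also have "(\<integral>z. F' z \<partial>(\<mu> \<Otimes>\<^sub>M \<mu>)) = (\<integral>z. F z \<partial>(\<mu> \<Otimes>\<^sub>M \<mu>))"
    unfolding F'_eq using F_int by (intro integral_product_swap) simp
  also have "(\<integral>z. F z \<partial>(\<mu> \<Otimes>\<^sub>M \<mu>)) = (\<integral>x. \<integral>y. F (x, y) \<partial>\<mu> \<partial>\<mu>)"
    by (rule integral_fst'[OF F_int, symmetric])
  finally show "2 * (\<integral>x. (\<integral>y. (g (w * x + (1 - w) * y) - g x) * indicat_real {y. \<bar>x - y\<bar> \<le> \<Delta>} y \<partial>\<mu>) \<partial>\<mu>)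
        = drift \<Delta> w g \<mu>"
    by (simp add: F_def)
qed

lemma
  assumes \<mu>: "\<mu> \<in> prob_unit" and "A \<in> sets unit_borel" "B \<in> sets unit_borel"
  shows integrable_indicator_Times:
      "integrable (\<mu> \<Otimes>\<^sub>M \<mu>) (\<lambda>z. indicat_real A (fst z) * indicat_real B (snd z))"
    and integral_indicator_Times:
      "(\<integral>z. indicat_real A (fst z) * indicat_real B (snd z) \<partial>(\<mu> \<Otimes>\<^sub>M \<mu>)) = measure \<mu> A * measure \<mu> B"
proof -
  interpret pair_prob_space \<mu> \<mu> by (rule prob_unit_pair_prob_space[OF \<mu>])
  have AB: "A \<in> sets \<mu>" "B \<in> sets \<mu>"
    using assms prob_unit_sets[OF \<mu>] by simp_all
  have eq: "(\<lambda>z. indicat_real A (fst z) * indicat_real B (snd z)) = indicat_real (A \<times> B)"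
    by (auto simp: indicator_def)
  show "integrable (\<mu> \<Otimes>\<^sub>M \<mu>) (\<lambda>z. indicat_real A (fst z) * indicat_real B (snd z))"
    unfolding eq using AB by (intro integrable_real_indicator) (auto simp: P.emeasure_eq_measure)
  show "(\<integral>z. indicat_real A (fst z) * indicat_real B (snd z) \<partial>(\<mu> \<Otimes>\<^sub>M \<mu>)) = measure \<mu> A * measure \<mu> B"
    unfolding eq using AB
    by (simp add: measure_def M1.emeasure_pair_measure_Times enn2real_mult)
qed

lemma
  assumes sol: "is_solution \<Delta> w m0 m" and w: "0 \<le> w" "w \<le> 1" and g: "observable g" and st: "0 \<le> s"
      "s \<le> t"
  shows has_integral_drift:
   "((\<lambda>u. drift \<Delta> w g (m u)) has_integral ((\<integral>x. g x \<partial>m t) - (\<integral>x. g x \<partial>m s))) {s..t}"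
proof -
  have *: "((\<lambda>u. drift \<Delta> w g (m u)) has_integral ((\<integral>x. g x \<partial>m t) - (\<integral>x. g x \<partial>m 0))) {0..t}"
      if "0 \<le> t" for t
  proof -
    have "((\<lambda>s. 2 * (\<integral>x. (\<integral>y. (g (w * x + (1 - w) * y) - g x) *
                            indicat_real {y. \<bar>x - y\<bar> \<le> \<Delta>} y \<partial>m s) \<partial>m s))
          has_integral ((\<integral>x. g x \<partial>m t) - (\<integral>x. g x \<partial>m 0))) {0..t}"
      using sol g that unfolding is_solution_def observable_def by blast
    then show ?thesis
      by (rule has_integral_eq[rotated])
        (rule drift_eq_collision_integral[OF w _ g], use sol in \<open>simp add: is_solution_def\<close>)
  qed
  have t: "0 \<le> t" using st by simp
  have "(\<lambda>u. drift \<Delta> w g (m u)) integrable_on {s..t}"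
    by (rule integrable_on_subinterval[OF has_integral_integrable[OF *[OF t]]])
      (use st in simp)
  then obtain I where I: "((\<lambda>u. drift \<Delta> w g (m u)) has_integral I) {s..t}" by blast
  have "((\<lambda>u. drift \<Delta> w g (m u)) has_integral ((\<integral>x. g x \<partial>m s) - (\<integral>x. g x \<partial>m 0)) + I) {0..t}"
    by (rule has_integral_combine[OF st *[OF st(1)] I])
  from has_integral_unique[OF this *[OF t]] have "I = (\<integral>x. g x \<partial>m t) - (\<integral>x. g x \<partial>m s)" by simp
  with I show ?thesis by simp
qed

lemma integral_mono_of_drift_nonneg:
  assumes "is_solution \<Delta> w m0 m" "0 \<le> w" "w \<le> 1" "observable g" "0 \<le> s" "s \<le> t"
    and "\<And>u. s \<le> u \<Longrightarrow> 0 \<le> drift \<Delta> w g (m u)"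
  shows "(\<integral>x. g x \<partial>m s) \<le> (\<integral>x. g x \<partial>m t)"
  using has_integral_nonneg[OF has_integral_drift[OF assms(1-6)]] assms(7) by simp

lemma integral_antimono_of_drift_nonpos:
  assumes "is_solution \<Delta> w m0 m" "0 \<le> w" "w \<le> 1" "observable g" "0 \<le> s" "s \<le> t"
    and "\<And>u. s \<le> u \<Longrightarrow> drift \<Delta> w g (m u) \<le> 0"
  shows "(\<integral>x. g x \<partial>m t) \<le> (\<integral>x. g x \<partial>m s)"
  using has_integral_nonneg[OF has_integral_neg[OF has_integral_drift[OF assms(1-6)]]] assms(7) by simp

text \<open>
  An interaction replaces a pair by two convex combinations of it with exchanged weights, so it
  decreases the sum of the values of a convex function.
\<close>
lemma integral_convex_le_initial:
  assumes sol: "is_solution \<Delta> w m0 m" and w: "0 \<le> w" "w \<le> 1" and h: "convex_on {0..1} h"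
      "continuous_on {0..1} h"
   and t: "0 \<le> t"
  shows "(\<integral>x. h x \<partial>m t) \<le> (\<integral>x. h x \<partial>m0)"
proof -
  have "(\<integral>x. h x \<partial>m t) \<le> (\<integral>x. h x \<partial>m 0)"
  proof (rule integral_antimono_of_drift_nonpos[OF sol w observable_continuous[OF h(2)] order_refl t])
    fix u :: real assume "0 \<le> u"
    then have \<mu>: "m u \<in> prob_unit" using sol by (simp add: is_solution_def)
    have "gain \<Delta> w h x y \<le> 0" if "x \<in> {0..1}" "y \<in> {0..1}" for x y
    proof -
      have "h (w * x + (1 - w) * y) \<le> w * h x + (1 - w) * h y"
        using convex_onD[OF h(1), of w y x] w that by (simp add: add.commute)
      moreover have "h (w * y + (1 - w) * x) \<le> w * h y + (1 - w) * h x"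
        using convex_onD[OF h(1), of w x y] w that by (simp add: add.commute)
      ultimately show ?thesis by (auto simp: gain_def indicator_def algebra_simps)
    qed
    then have "gain \<Delta> w h (fst z) (snd z) \<le> 0" if "z \<in> space (m u \<Otimes>\<^sub>M m u)" for z
      using that prob_unit_pair_space[OF \<mu>] by auto
    then have "0 \<le> (\<integral>z. - gain \<Delta> w h (fst z) (snd z) \<partial>(m u \<Otimes>\<^sub>M m u))"
      by (intro Bochner_Integration.integral_nonneg) auto
    then show "drift \<Delta> w h (m u) \<le> 0" by (simp add: drift_def)
  qed
  then show ?thesis using sol by (simp add: is_solution_def)
qed

section \<open>Mass on the inner side of a limiting atom\<close>
lemma sets_unit_borel_Collect:
  assumes "Measurable.pred borel P"
  shows "{x \<in> {0..1}. P x} \<in> sets unit_borel"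
proof -
  have "{x \<in> {0..1}. P x} = {0..1} \<inter> {x. P x}" by auto
  with assms show ?thesis unfolding unit_borel_def sets_restrict_space by (auto simp: pred_def)
qed

lemma integral_le_measure:
  assumes \<mu>: "\<mu> \<in> prob_unit" and "observable g" and "Measurable.pred borel P"
    and "\<And>x. x \<in> {0..1} \<Longrightarrow> g x \<le> (if P x then 1 else 0)"
  shows "(\<integral>x. g x \<partial>\<mu>) \<le> measure \<mu> {x \<in> {0..1}. P x}"
proof -
  interpret prob_space \<mu> by (rule prob_unit_prob_space[OF \<mu>])
  have S: "{x \<in> {0..1}. P x} \<in> sets \<mu>"
    using sets_unit_borel_Collect[OF assms(3)] prob_unit_sets[OF \<mu>] by simp
  have "(\<integral>x. g x \<partial>\<mu>) \<le> (\<integral>x. indicat_real {x \<in> {0..1}. P x} x \<partial>\<mu>)"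
  proof (rule integral_mono[OF integrable_observable[OF \<mu> assms(2)]])
    show "integrable \<mu> (indicat_real {x \<in> {0..1}. P x})"
      using S by (intro integrable_real_indicator) (auto simp: emeasure_eq_measure)
    show "g x \<le> indicat_real {x \<in> {0..1}. P x} x" if "x \<in> space \<mu>" for x
      using assms(4)[of x] that by (auto simp: prob_unit_space[OF \<mu>] indicator_def split: if_splits)
  qed
  with S show ?thesis by simp
qed

lemma measure_le_integral:
  assumes \<mu>: "\<mu> \<in> prob_unit" and "observable g" and "Measurable.pred borel P"
    and "\<And>x. x \<in> {0..1} \<Longrightarrow> (if P x then 1 else 0) \<le> g x"
  shows "measure \<mu> {x \<in> {0..1}. P x} \<le> (\<integral>x. g x \<partial>\<mu>)"
proof -
  interpret prob_space \<mu> by (rule prob_unit_prob_space[OF \<mu>])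
  have S: "{x \<in> {0..1}. P x} \<in> sets \<mu>"
    using sets_unit_borel_Collect[OF assms(3)] prob_unit_sets[OF \<mu>] by simp
  have "(\<integral>x. indicat_real {x \<in> {0..1}. P x} x \<partial>\<mu>) \<le> (\<integral>x. g x \<partial>\<mu>)"
  proof (rule integral_mono[OF _ integrable_observable[OF \<mu> assms(2)]])
    show "integrable \<mu> (indicat_real {x \<in> {0..1}. P x})"
      using S by (intro integrable_real_indicator) (auto simp: emeasure_eq_measure)
    show "indicat_real {x \<in> {0..1}. P x} x \<le> g x" if "x \<in> space \<mu>" for x
      using assms(4)[of x] that by (auto simp: prob_unit_space[OF \<mu>] indicator_def split: if_splits)
  qed
  with S show ?thesis by simp
qed

lemma not_has_integral_0_of_pos:
  fixes f :: "real \<Rightarrow> real"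
  assumes "a < b" and "\<And>x. x \<in> {a..b} \<Longrightarrow> 0 < f x" and "(f has_integral 0) {a..b}"
  shows False
proof -
  have int: "f integrable_on {a..b}" using assms(3) by blast
  have abs: "f absolutely_integrable_on {a..b}"
    using int assms(2) by (intro nonnegative_absolutely_integrable_1) (auto intro: less_imp_le)
  have "(LINT x:{a..b}|lebesgue. f x) = 0"
    using set_lebesgue_integral_eq_integral(2)[OF abs] assms(3) by (simp add: integral_unique)
  then have "AE x in lebesgue. indicat_real {a..b} x *\<^sub>R f x = 0"
    using abs assms(2) unfolding set_lebesgue_integral_def set_integrable_def
    by (subst (asm) integral_nonneg_eq_0_iff_AE) (auto simp: indicator_def intro: less_imp_le)
  then have "AE x in lebesgue. x \<notin> {a..b}"
    by eventually_elim (use assms(2) in \<open>force simp: indicator_def\<close>)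
  then have "{a..b} \<in> null_sets lebesgue"
    by (subst (asm) AE_iff_null_sets[symmetric]) auto
  then show False
    using assms(1) by (auto simp: null_sets_def)
qed

text \<open>
  The sign \<open>\<sigma>\<close> lets one lemma serve both ends of a gap: \<open>u x = \<sigma> (x - p)\<close> is the position relative
  to \<open>p\<close>, counted towards the gap \<open>r < u < \<Delta> - r\<close>, which carries no mass. The assumption \<open>lim\<close> is
  what weak convergence gives when the limit has an atom of mass \<open>\<beta>\<close> at \<open>p\<close> and its other atoms are
  at distance at least \<open>\<Delta>\<close> from \<open>p\<close>.

  Take \<open>\<phi> = (\<epsilon> + u)\<^sup>+\<close> on \<open>u \<le> r\<close> and \<open>\<phi> = 0\<close> elsewhere. Pairs on the near side of the gap see a convex
  function; pairs on the far side see zero; and a pair that interacts across the gap has both members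
  jump beyond \<open>r\<close>, where \<open>\<phi> = 0\<close>. So the integral of \<open>\<phi>\<close> decreases in time and is
  always at least its limit \<open>\<beta> \<epsilon>\<close>. If there were no mass in \<open>0 \<le> u \<le> r\<close>, then \<open>\<phi> \<le> \<epsilon>\<close> would be carried
  by \<open>-\<epsilon> \<le> u < 0\<close> alone, and this set would have mass at least \<open>\<beta>\<close> for every \<open>\<epsilon>\<close>, although these
  sets shrink to the empty set.
\<close>
lemma charged_inner_side:
  fixes \<Delta> w p \<sigma> r \<beta> T t :: real
  assumes sol: "is_solution \<Delta> w m0 m" and w: "0 < w" "w < 1"
    and \<sigma>: "\<sigma> = 1 \<or> \<sigma> = -1"
    and r: "0 < r" "4 * r \<le> \<Delta>" "2 * r < w * \<Delta>" "2 * r < (1 - w) * \<Delta>"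
    and T: "0 \<le> T"
    and null: "\<And>t. T \<le> t \<Longrightarrow> measure (m t) {x \<in> {0..1}. r < \<sigma> * (x - p) \<and> \<sigma> * (x - p) < \<Delta> - r} = 0"
    and lim: "\<And>\<epsilon>. 0 < \<epsilon> \<Longrightarrow> \<epsilon> \<le> r \<Longrightarrow>
      ((\<lambda>t. \<integral>x. max 0 (min (\<epsilon> + \<sigma> * (x - p)) (\<Delta> - r - \<sigma> * (x - p))) \<partial>m t) \<longlongrightarrow> \<beta> * \<epsilon>) at_top"
    and \<beta>: "0 < \<beta>" and t: "T \<le> t"
  shows "0 < measure (m t) {x \<in> {0..1}. 0 \<le> \<sigma> * (x - p) \<and> \<sigma> * (x - p) \<le> r}"
proof -
  define u where "u x = \<sigma> * (x - p)" for x
  define S where "S = {x \<in> {0..1}. r < u x \<and> u x < \<Delta> - r}"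
  define \<phi> where "\<phi> \<epsilon> x = (if u x \<le> r then max 0 (\<epsilon> + u x) else 0)" for \<epsilon> x
  have u_meas [measurable]: "u \<in> borel_measurable borel" unfolding u_def by measurable
  have prob: "m s \<in> prob_unit" if "T \<le> s" for s
    using sol T that by (simp add: is_solution_def)
  have u_mix: "u (w * x + (1 - w) * y) = w * u x + (1 - w) * u y" for w x y
    by (simp add: u_def algebra_simps)
  have u_dist: "\<bar>u x - u y\<bar> = \<bar>x - y\<bar>" for x y
    using \<sigma> by (auto simp: u_def)
  have "S \<in> sets unit_borel"
    unfolding S_def by (intro sets_unit_borel_Collect) measurable
  note S_sets = this unit_interval_sets
  have S_null: "measure (m s) S = 0" if "T \<le> s" for s
    using null[OF that] by (simp add: S_def u_def)
  have not_S: "AE x in m s. x \<notin> S" if "T \<le> s" for s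
  proof -
    interpret prob_space "m s" by (rule prob_unit_prob_space[OF prob[OF that]])
    show ?thesis
      using S_null[OF that] S_sets prob_unit_sets[OF prob[OF that]]
      by (intro AE_not_in) (simp add: null_sets_def emeasure_eq_measure)
  qed
  have obs: "observable (\<phi> \<epsilon>)" if "0 < \<epsilon>" "\<epsilon> \<le> r" for \<epsilon>
  proof (rule observable_bounded_measurable[where B = "2 * r"])
    show "\<phi> \<epsilon> \<in> borel_measurable borel" unfolding \<phi>_def by measurable
  qed (use that r in \<open>auto simp: \<phi>_def\<close>)
  have \<phi>_bounds: "0 \<le> \<phi> \<epsilon> x" "\<phi> \<epsilon> x \<le> 2 * r" if "0 < \<epsilon>" "\<epsilon> \<le> r" for \<epsilon> x
    using that r by (auto simp: \<phi>_def)
  have \<phi>_convex: "\<phi> \<epsilon> (\<theta> * x + (1 - \<theta>) * y) \<le> \<theta> * \<phi> \<epsilon> x + (1 - \<theta>) * \<phi> \<epsilon> y"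
    if "0 < \<theta>" "\<theta> < 1" "u x \<le> r" "u y \<le> r" for \<epsilon> \<theta> x y
  proof -
    have "\<theta> * (\<epsilon> + u x) \<le> \<theta> * max 0 (\<epsilon> + u x)" "(1 - \<theta>) * (\<epsilon> + u y) \<le> (1 - \<theta>) * max 0 (\<epsilon> + u y)"
      using that by (auto intro!: mult_left_mono)
    moreover have "0 \<le> \<theta> * max 0 (\<epsilon> + u x)" "0 \<le> (1 - \<theta>) * max 0 (\<epsilon> + u y)"
      using that by auto
    moreover have "\<epsilon> + u (\<theta> * x + (1 - \<theta>) * y) = \<theta> * (\<epsilon> + u x) + (1 - \<theta>) * (\<epsilon> + u y)"
      unfolding u_mix by (simp add: algebra_simps)
    ultimately have "max 0 (\<epsilon> + u (\<theta> * x + (1 - \<theta>) * y))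
        \<le> \<theta> * max 0 (\<epsilon> + u x) + (1 - \<theta>) * max 0 (\<epsilon> + u y)"
      by linarith
    moreover have "\<phi> \<epsilon> (\<theta> * x + (1 - \<theta>) * y) \<le> max 0 (\<epsilon> + u (\<theta> * x + (1 - \<theta>) * y))"
      by (simp add: \<phi>_def)
    ultimately show ?thesis
      using that by (simp add: \<phi>_def)
  qed
  have cross: "\<phi> \<epsilon> (\<theta> * x + (1 - \<theta>) * y) = 0"
    if "0 < \<theta>" "\<theta> < 1" "2 * r < \<theta> * \<Delta>" "2 * r < (1 - \<theta>) * \<Delta>" "- r \<le> u x" "\<Delta> - r \<le> u y" for \<epsilon> \<theta> x y
  proof -
    have "\<theta> * (- r) \<le> \<theta> * u x" "(1 - \<theta>) * (\<Delta> - r) \<le> (1 - \<theta>) * u y"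
      using that by (simp_all only: mult_left_mono less_imp_le diff_ge_0_iff_ge)
    then have "r < u (\<theta> * x + (1 - \<theta>) * y)"
      using that unfolding u_mix by (simp add: algebra_simps)
    then show ?thesis by (simp add: \<phi>_def)
  qed
  have gain_bound: "gain \<Delta> w (\<phi> \<epsilon>) x y \<le> 4 * r * (indicat_real S x * indicat_real {0..1} y)
      + 4 * r * (indicat_real {0..1} x * indicat_real S y)"
    if \<epsilon>: "0 < \<epsilon>" "\<epsilon> \<le> r" and xy: "x \<in> {0..1}" "y \<in> {0..1}" for \<epsilon> x y
  proof (cases "x \<in> S \<or> y \<in> S")
    case True
    have "gain \<Delta> w (\<phi> \<epsilon>) x y \<le> 4 * r"
      using \<phi>_bounds[OF \<epsilon>, of x] \<phi>_bounds[OF \<epsilon>, of y] \<phi>_bounds[OF \<epsilon>, of "w * x + (1 - w) * y"]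
        \<phi>_bounds[OF \<epsilon>, of "w * y + (1 - w) * x"] r
      by (auto simp: gain_def indicator_def)
    also have "\<dots> \<le> 4 * r * (indicat_real S x * indicat_real {0..1} y)
      + 4 * r * (indicat_real {0..1} x * indicat_real S y)"
      using True xy r by (auto simp: indicator_def)
    finally show ?thesis .
  next
    case False
    have "gain \<Delta> w (\<phi> \<epsilon>) x y \<le> 0"
    proof (cases "\<bar>x - y\<bar> \<le> \<Delta>")
      case close: True
      have swap: "(1 - w) * x + (1 - (1 - w)) * y = w * y + (1 - w) * x"
          "(1 - w) * y + (1 - (1 - w)) * x = w * x + (1 - w) * y"
        by simp_all
      from False xy consider "u x \<le> r" "u y \<le> r" | "u x \<le> r" "\<Delta> - r \<le> u y" | "\<Delta> - r \<le> u x" "u y \<le> r"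
        | "\<Delta> - r \<le> u x" "\<Delta> - r \<le> u y"
        unfolding S_def by force
      then have "\<phi> \<epsilon> (w * x + (1 - w) * y) + \<phi> \<epsilon> (w * y + (1 - w) * x) \<le> \<phi> \<epsilon> x + \<phi> \<epsilon> y"
      proof cases
        case 1
        then show ?thesis using \<phi>_convex[OF w, of x y \<epsilon>] \<phi>_convex[OF w, of y x \<epsilon>]
            by (simp add: algebra_simps)
      next
        case 2
        then have "- r \<le> u x" using close u_dist[of x y] by linarith
        with 2 show ?thesis
          using cross[of w x y \<epsilon>] cross[of "1 - w" x y \<epsilon>] w r \<phi>_bounds[OF \<epsilon>, of x] \<phi>_bounds[OF \<epsilon>, of y]
          unfolding swap by simp
      next
        case 3
        then have "- r \<le> u y" using close u_dist[of x y] by linarith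
        with 3 show ?thesis
          using cross[of w y x \<epsilon>] cross[of "1 - w" y x \<epsilon>] w r \<phi>_bounds[OF \<epsilon>, of x] \<phi>_bounds[OF \<epsilon>, of y]
          unfolding swap by simp
      next
        case 4
        then show ?thesis
          using cross[of w x y \<epsilon>] cross[of "1 - w" x y \<epsilon>] w r \<phi>_bounds[OF \<epsilon>, of x] \<phi>_bounds[OF \<epsilon>, of y]
          unfolding swap by simp
      qed
      with close show ?thesis by (simp add: gain_def)
    qed (simp add: gain_def indicator_def)
    also have "0 \<le> 4 * r * (indicat_real S x * indicat_real {0..1} y)
      + 4 * r * (indicat_real {0..1} x * indicat_real S y)"
      using r by simp
    finally show ?thesis .
  qed
  have drift_nonpos: "drift \<Delta> w (\<phi> \<epsilon>) (m s) \<le> 0" if \<epsilon>: "0 < \<epsilon>" "\<epsilon> \<le> r" and s: "T \<le> s" for \<epsilon> s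
  proof -
    note \<mu> = prob[OF s]
    have "drift \<Delta> w (\<phi> \<epsilon>) (m s) \<le> (\<integral>z. 4 * r * (indicat_real S (fst z) * indicat_real {0..1} (snd z))
      + 4 * r * (indicat_real {0..1} (fst z) * indicat_real S (snd z)) \<partial>(m s \<Otimes>\<^sub>M m s))"
      unfolding drift_def
    proof (rule integral_mono)
      show "integrable (m s \<Otimes>\<^sub>M m s) (\<lambda>z. gain \<Delta> w (\<phi> \<epsilon>) (fst z) (snd z))"
        using integrable_gain[OF _ _ \<mu> obs[OF \<epsilon>]] w by simp
      show "integrable (m s \<Otimes>\<^sub>M m s) (\<lambda>z. 4 * r * (indicat_real S (fst z) * indicat_real {0..1} (snd z))
          + 4 * r * (indicat_real {0..1} (fst z) * indicat_real S (snd z)))"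
        using integrable_indicator_Times[OF \<mu>] S_sets by simp
    qed (use gain_bound[OF \<epsilon>] in \<open>auto simp: prob_unit_pair_space[OF \<mu>]\<close>)
    also have "\<dots> = 0"
      using integrable_indicator_Times[OF \<mu>] integral_indicator_Times[OF \<mu>] S_sets S_null[OF s] by simp
    finally show ?thesis .
  qed
  have limit_bound: "\<beta> * \<epsilon> \<le> (\<integral>x. \<phi> \<epsilon> x \<partial>m t)" if \<epsilon>: "0 < \<epsilon>" "\<epsilon> \<le> r" for \<epsilon>
  proof (rule tendsto_upperbound[OF lim[OF \<epsilon>]])
    show "\<forall>\<^sub>F s in at_top. (\<integral>x. max 0 (min (\<epsilon> + \<sigma> * (x - p)) (\<Delta> - r - \<sigma> * (x - p))) \<partial>m s)
        \<le> (\<integral>x. \<phi> \<epsilon> x \<partial>m t)"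
      using eventually_ge_at_top[of t]
    proof eventually_elim
      case (elim s)
      with t have s: "T \<le> s" by simp
      \<comment> \<open>The continuous integrand of \<open>lim\<close> differs from \<open>\<phi>\<close> only in the gap.\<close>
      have "(\<integral>x. max 0 (min (\<epsilon> + \<sigma> * (x - p)) (\<Delta> - r - \<sigma> * (x - p))) \<partial>m s) = (\<integral>x. \<phi> \<epsilon> x \<partial>m s)"
      proof (rule integral_cong_AE)
        show "(\<lambda>x. max 0 (min (\<epsilon> + \<sigma> * (x - p)) (\<Delta> - r - \<sigma> * (x - p)))) \<in> borel_measurable (m s)"
          unfolding prob_unit_measurable[OF prob[OF s]] by (rule measurable_unit_borelI) measurable
        show "\<phi> \<epsilon> \<in> borel_measurable (m s)"
          using obs[OF \<epsilon>] by (simp add: prob_unit_measurable[OF prob[OF s]] observable_def)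
        show "AE x in m s. max 0 (min (\<epsilon> + \<sigma> * (x - p)) (\<Delta> - r - \<sigma> * (x - p))) = \<phi> \<epsilon> x"
          using not_S[OF s] AE_space
        proof eventually_elim
          case (elim x)
          then have "u x \<le> r \<or> \<Delta> - r \<le> u x" by (auto simp: S_def prob_unit_space[OF prob[OF s]])
          then show ?case unfolding \<phi>_def u_def[symmetric] using \<epsilon> r by auto
        qed
      qed
      also have "\<dots> \<le> (\<integral>x. \<phi> \<epsilon> x \<partial>m t)"
        by (rule integral_antimono_of_drift_nonpos[OF sol _ _ obs[OF \<epsilon>] _ elim])
          (use w T t drift_nonpos[OF \<epsilon>] in auto)
      finally show ?case .
    qed
  qed simp
  interpret prob_space "m t" by (rule prob_unit_prob_space[OF prob[OF t]])
  note \<mu> = prob[OF t]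
  define I where "I = {x \<in> {0..1}. 0 \<le> u x \<and> u x \<le> r}"
  have I_sets: "I \<in> events"
    unfolding I_def prob_unit_sets[OF \<mu>] by (intro sets_unit_borel_Collect) measurable
  show ?thesis
  proof (rule ccontr)
    assume "\<not> ?thesis"
    then have "prob I = 0"
      by (simp add: I_def u_def zero_less_measure_iff)
    then have not_I: "AE x in m t. x \<notin> I"
      using I_sets by (intro AE_not_in) (simp add: null_sets_def emeasure_eq_measure)
    define E where "E \<epsilon> = {x \<in> {0..1}. - \<epsilon> \<le> u x \<and> u x < 0}" for \<epsilon> :: real
    have E_sets: "E \<epsilon> \<in> events" for \<epsilon>
      unfolding E_def prob_unit_sets[OF \<mu>] by (intro sets_unit_borel_Collect) measurable
    have E_bound: "\<beta> \<le> prob (E \<epsilon>)" if \<epsilon>: "0 < \<epsilon>" "\<epsilon> \<le> r" for \<epsilon>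
    proof -
      have "\<beta> * \<epsilon> \<le> (\<integral>x. \<phi> \<epsilon> x \<partial>m t)" by (rule limit_bound[OF \<epsilon>])
      also have "\<dots> \<le> (\<integral>x. \<epsilon> * indicat_real (E \<epsilon>) x \<partial>m t)"
      proof (rule integral_mono_AE)
        show "AE x in m t. \<phi> \<epsilon> x \<le> \<epsilon> * indicat_real (E \<epsilon>) x"
          using not_I AE_space
          by eventually_elim (use \<epsilon> in \<open>auto simp: \<phi>_def I_def E_def indicator_def prob_unit_space[OF \<mu>]\<close>)
        show "integrable (m t) (\<lambda>x. \<epsilon> * indicat_real (E \<epsilon>) x)"
          using E_sets by (intro integrable_mult_right integrable_real_indicator)
              (auto simp: emeasure_eq_measure)
      qed (rule integrable_observable[OF \<mu> obs[OF \<epsilon>]])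
      also have "\<dots> = \<epsilon> * prob (E \<epsilon>)" using E_sets by simp
      finally show ?thesis using \<epsilon> by (simp add: mult.commute)
    qed
    have "(\<lambda>n. prob (E (r / real (Suc n)))) \<longlonglongrightarrow> prob (\<Inter>n. E (r / real (Suc n)))"
    proof (rule finite_Lim_measure_decseq)
      show "range (\<lambda>n. E (r / real (Suc n))) \<subseteq> events" using E_sets by auto
      have "r / real (Suc (Suc n)) \<le> r / real (Suc n)" for n
        by (rule divide_left_mono) (use r in auto)
      moreover have "E a \<subseteq> E b" if "a \<le> b" for a b
        using that by (auto simp: E_def)
      ultimately show "decseq (\<lambda>n. E (r / real (Suc n)))"
        unfolding decseq_Suc_iff by blast
    qed
    moreover have "(\<Inter>n. E (r / real (Suc n))) = {}"
    proof (rule ccontr)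
      assume "(\<Inter>n. E (r / real (Suc n))) \<noteq> {}"
      then obtain x where x: "\<And>n. x \<in> E (r / real (Suc n))" by auto
      then have "u x < 0" by (auto simp: E_def)
      then obtain n where "r / (- u x) < real n" using reals_Archimedean2 by blast
      moreover have "- (r / real (Suc n)) \<le> u x" using x[of n] by (simp add: E_def)
      ultimately show False
        using \<open>u x < 0\<close> r by (simp add: field_simps)
    qed
    ultimately have "(\<lambda>n. prob (E (r / real (Suc n)))) \<longlonglongrightarrow> 0" by simp
    then have "\<beta> \<le> 0"
    proof (rule tendsto_lowerbound)
      have "r / real (Suc n) \<le> r" for n
        using r divide_left_mono[of 1 "real (Suc n)" r] by simp
      then show "\<forall>\<^sub>F n in sequentially. \<beta> \<le> prob (E (r / real (Suc n)))"
        using r by (intro always_eventually allI E_bound) auto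
    qed simp
    with \<beta> show False by simp
  qed
qed

section \<open>Dust between two clusters at the interaction distance\<close>

text \<open>
  The weight with which mass between \<open>A\<close> and \<open>B\<close> is counted as dust. A weight of constant second
  derivative gains the same multiple of \<open>(x - y)\<^sup>2\<close> from every interaction; see \<open>hump_mixture_sum\<close>.
\<close>
definition hump :: "real \<Rightarrow> real \<Rightarrow> real \<Rightarrow> real" where
  "hump A B x = max 0 ((x - A) * (B - x))"

lemma hump_nonneg: "0 \<le> hump A B x" by (simp add: hump_def)

lemma hump_pos_iff: "A < B \<Longrightarrow> 0 < hump A B x \<longleftrightarrow> A < x \<and> x < B"
  by (auto simp: hump_def zero_less_mult_iff less_max_iff_disj)

lemma hump_eq_0: "A < B \<Longrightarrow> \<not> (A < x \<and> x < B) \<Longrightarrow> hump A B x = 0"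
  using hump_pos_iff[of A B x] hump_nonneg[of A B x] by linarith

lemma hump_eq: "A < x \<Longrightarrow> x < B \<Longrightarrow> hump A B x = (x - A) * (B - x)"
  by (simp add: hump_def)

lemma observable_hump: "observable (hump A B)"
  unfolding hump_def by (intro observable_continuous continuous_intros)

lemma hump_mixture_sum:
  "(x - A) * (B - x) + (y - A) * (B - y) + 2 * w * (1 - w) * (x - y)\<^sup>2
    \<le> hump A B (w * x + (1 - w) * y) + hump A B (w * y + (1 - w) * x)"
proof -
  let ?H = "\<lambda>x. (x - A) * (B - x)"
  have "?H x + ?H y + 2 * w * (1 - w) * (x - y)\<^sup>2 = ?H (w * x + (1 - w) * y) + ?H (w * y + (1 - w) * x)"
    by algebra
  also have "\<dots> \<le> hump A B (w * x + (1 - w) * y) + hump A B (w * y + (1 - w) * x)"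
    unfolding hump_def by (intro add_mono max.cobounded2)
  finally show ?thesis .
qed

text \<open>
  Let \<open>H x = (x - A) (B - x)\<close> with \<open>A = p + r\<close> and \<open>B = p + \<Delta> - r\<close>, and let \<open>x\<close> be dust.
  \<^item> If \<open>y\<close> lies in one of the two clusters, then \<open>x\<close> and \<open>y\<close> interact and \<open>H\<close> gains
    \<open>2 w (1 - w) (x - y)\<^sup>2 + H y\<close>. The first term is at least
    \<open>c = w (1 - w) \<Delta>\<^sup>2 / 4\<close> for the cluster that is farther from \<open>x\<close>, of mass at least \<open>a\<close>, and
    \<open>H y \<ge> - 2 r\<close>. So the clusters contribute at least
    \<open>a c - 2 r = 2 r\<close> per unit mass of dust; the value of \<open>r\<close> is chosen to make \<open>a c = 4 r\<close>.
  \<^item> If \<open>y\<close> lies elsewhere within distance \<open>\<Delta>\<close>, then at worst the weight of \<open>x\<close>, at most 1, is lost.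
    Such \<open>y\<close> lie in the set of mass at most \<open>2 r\<close> of the last assumption.
\<close>
lemma drift_hump_nonneg:
  fixes \<Delta> w p r a :: real
  assumes \<mu>: "\<mu> \<in> prob_unit" and w: "0 < w" "w < 1" and \<Delta>: "0 < \<Delta>" "\<Delta> \<le> 1"
    and a: "0 < a" "a \<le> 1" and r: "r = a * w * (1 - w) * \<Delta>\<^sup>2 / 16"
    and C1: "a \<le> measure \<mu> {x \<in> {0..1}. \<bar>x - p\<bar> \<le> r}"
    and C2: "a \<le> measure \<mu> {x \<in> {0..1}. \<bar>x - (p + \<Delta>)\<bar> \<le> r}"
    and D: "measure \<mu> {x \<in> {0..1}. r < \<bar>x - p\<bar> \<and> r < \<bar>x - (p + \<Delta>)\<bar> \<and> r < x - p + \<Delta>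
        \<and> r < p + 2 * \<Delta> - x} \<le> 2 * r"
      (is "measure \<mu> ?D \<le> _")
  shows "0 \<le> drift \<Delta> w (hump (p + r) (p + \<Delta> - r)) \<mu>"
proof -
  define A B where "A = p + r" and "B = p + \<Delta> - r"
  have w1: "0 < w * (1 - w)" "w * (1 - w) \<le> 1"
    using w mult_le_one[of w "1 - w"] by auto
  have "a * (w * (1 - w)) \<le> 1" "\<Delta>\<^sup>2 \<le> \<Delta>"
    using a w1 \<Delta> mult_le_one[of a "w * (1 - w)"] mult_left_le[of \<Delta> \<Delta>] by (auto simp: power2_eq_square)
  then have "a * (w * (1 - w)) * \<Delta>\<^sup>2 \<le> 1 * \<Delta>"
    using a w1 \<Delta> by (intro mult_mono) auto
  then have r_small: "8 * r \<le> \<Delta>" using \<Delta> unfolding r by (simp add: mult.assoc)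
  have r_pos: "0 < r" using a w \<Delta> by (simp add: r)
  have AB: "A < B" using r_small r_pos by (simp add: A_def B_def)
  define c where "c = w * (1 - w) * \<Delta>\<^sup>2 / 4"
  have ac: "a * c = 4 * r" by (simp add: c_def r)
  have c_pos: "0 < c" using w1 \<Delta> by (simp add: c_def)
  let ?f = "hump A B"
  define S where "S = {x \<in> {0..1}. A < x \<and> x < B}"
  define Sr where "Sr = {x \<in> {0..1}. A < x \<and> x < B \<and> p + \<Delta> / 2 \<le> x}"
  define Sl where "Sl = {x \<in> {0..1}. A < x \<and> x < B \<and> x < p + \<Delta> / 2}"
  define K1 where "K1 = {x \<in> {0..1}. \<bar>x - p\<bar> \<le> r}"
  define K2 where "K2 = {x \<in> {0..1}. \<bar>x - (p + \<Delta>)\<bar> \<le> r}"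
  define U where "U = {0..1 :: real}"
  note set_defs = S_def Sr_def Sl_def K1_def K2_def U_def
  have sets: "S \<in> sets unit_borel" "Sr \<in> sets unit_borel" "Sl \<in> sets unit_borel" "K1 \<in> sets unit_borel"
     "K2 \<in> sets unit_borel" "?D \<in> sets unit_borel"
    unfolding set_defs by (intro sets_unit_borel_Collect; measurable)+
  have U_sets: "U \<in> sets unit_borel" unfolding U_def by (rule unit_interval_sets)
  \<comment> \<open>\<open>L x y\<close> is the guaranteed contribution of \<open>x\<close>, when it is dust, to the gain of the pair. It is a
    combination of products of indicators, so that its integral is explicit.\<close>
  define L where "L x y = c * (indicat_real Sr x * indicat_real K1 y)
      + c * (indicat_real Sl x * indicat_real K2 y)
    - 2 * r * (indicat_real S x * indicat_real U y) - indicat_real S x * indicat_real ?D y" for x y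
  have L_outside: "L x y = 0" if "x \<notin> S" for x y
    using that by (auto simp: L_def set_defs)
  have f_le_1: "?f x \<le> 1" if "x \<in> S" for x
  proof -
    have "(x - A) * (B - x) \<le> 1"
      using that r_pos \<Delta> by (intro mult_le_one) (auto simp: S_def A_def B_def)
    with that show ?thesis by (simp add: S_def hump_eq)
  qed
  have f_out: "?f x = 0" if "x \<notin> S" "x \<in> {0..1}" for x
    using that AB by (intro hump_eq_0) (auto simp: S_def)
  have dust_cluster: "L x y \<le> gain \<Delta> w ?f x y" if x: "x \<in> S" and y: "y \<in> K1 \<union> K2" for x y
  proof -
    have yS: "y \<notin> S" "y \<in> {0..1}" "y \<notin> ?D" using y r_small r_pos by (auto simp: set_defs A_def B_def)
    have close: "\<bar>x - y\<bar> \<le> \<Delta>" using x y r_small r_pos by (auto simp: set_defs A_def B_def)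
    have "- (2 * r) \<le> (y - A) * (B - y)"
    proof -
      from y consider "0 \<le> A - y" "A - y \<le> 2 * r" "0 \<le> B - y" "B - y \<le> 1"
        | "0 \<le> y - B" "y - B \<le> 2 * r" "0 \<le> y - A" "y - A \<le> 1"
        using r_small r_pos \<Delta> by (auto simp: set_defs A_def B_def)
      then show ?thesis
      proof cases
        case 1
        then have "(A - y) * (B - y) \<le> (2 * r) * 1" using r_pos by (intro mult_mono) auto
        then show ?thesis by (simp add: algebra_simps)
      next
        case 2
        then have "(y - B) * (y - A) \<le> (2 * r) * 1" using r_pos by (intro mult_mono) auto
        then show ?thesis by (simp add: algebra_simps)
      qed
    qed
    moreover have "gain \<Delta> w ?f x y
        = ?f (w * x + (1 - w) * y) + ?f (w * y + (1 - w) * x) - (x - A) * (B - x)"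
      using close f_out[OF yS(1,2)] x by (simp add: gain_def S_def hump_eq)
    ultimately have g: "2 * w * (1 - w) * (x - y)\<^sup>2 - 2 * r \<le> gain \<Delta> w ?f x y"
      using hump_mixture_sum[of x A B y w] by simp
    \<comment> \<open>Dust in one half of the gap is at distance at least \<open>\<Delta>/2 - r\<close> from the cluster at the other
      end, and \<open>8 r \<le> \<Delta>\<close>.\<close>
    have far: "c \<le> 2 * w * (1 - w) * (x - y)\<^sup>2" if "3 * \<Delta> / 8 \<le> \<bar>x - y\<bar>"
    proof -
      have "(3 * \<Delta> / 8)\<^sup>2 \<le> \<bar>x - y\<bar>\<^sup>2" using that \<Delta> by (intro power_mono) auto
      moreover have "0 \<le> \<Delta>\<^sup>2" "(3 * \<Delta> / 8)\<^sup>2 = 9 / 64 * \<Delta>\<^sup>2" by (simp_all add: power2_eq_square)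
      ultimately have "\<Delta>\<^sup>2 / 8 \<le> (x - y)\<^sup>2" unfolding power2_abs by linarith
      then have "2 * (w * (1 - w)) * (\<Delta>\<^sup>2 / 8) \<le> 2 * (w * (1 - w)) * (x - y)\<^sup>2"
        using w1 by (intro mult_left_mono) auto
      then show ?thesis by (simp add: c_def mult.assoc)
    qed
    have nonneg: "0 \<le> 2 * w * (1 - w) * (x - y)\<^sup>2" using w by simp
    have Ly: "L x y = c * (indicat_real Sr x * indicat_real K1 y)
        + c * (indicat_real Sl x * indicat_real K2 y) - 2 * r"
      using x yS by (simp add: L_def U_def)
    show ?thesis
    proof (cases "x \<in> Sr \<and> y \<in> K1 \<or> x \<in> Sl \<and> y \<in> K2")
      case True
      then have "3 * \<Delta> / 8 \<le> \<bar>x - y\<bar>" using r_small r_pos by (auto simp: set_defs)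
      moreover have "\<not> (x \<in> Sr \<and> x \<in> Sl)" by (auto simp: set_defs)
      ultimately show ?thesis using far g c_pos True unfolding Ly by (auto simp: indicator_def)
    next
      case False
      then have "L x y = - 2 * r" unfolding Ly by (auto simp: indicator_def)
      with g nonneg show ?thesis by simp
    qed
  qed
  have dust_other: "L x y \<le> - (?f x * indicat_real {y. \<bar>x - y\<bar> \<le> \<Delta>} y)" if x: "x \<in> S"
      and y: "y \<in> {0..1}" "y \<notin> K1 \<union> K2" for x y
  proof -
    have L: "L x y = - 2 * r - indicat_real ?D y" using x y by (simp add: L_def U_def)
    show ?thesis
    proof (cases "\<bar>x - y\<bar> \<le> \<Delta>")
      case True
      then have "y \<in> ?D" using x y r_pos by (auto simp: set_defs A_def B_def)
      then show ?thesis using L f_le_1[OF x] r_pos True by simp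
    next
      case False
      then show ?thesis using L r_pos by (simp add: indicator_def)
    qed
  qed
  have gain_sym: "gain \<Delta> w ?f x y = gain \<Delta> w ?f y x" for x y
    by (simp add: gain_def indicator_def abs_minus_commute)
  have gain_lower: "- (?f x * indicat_real {y. \<bar>x - y\<bar> \<le> \<Delta>} y) - ?f y * indicat_real {x. \<bar>y - x\<bar>
      \<le> \<Delta>} x \<le> gain \<Delta> w ?f x y" for x y
    using hump_nonneg[of A B "w * x + (1 - w) * y"] hump_nonneg[of A B "w * y + (1 - w) * x"]
    by (auto simp: gain_def indicator_def)
  have S_disj: "x \<notin> K1 \<union> K2" if "x \<in> S" for x
    using that r_small r_pos by (auto simp: set_defs A_def B_def)
  have key: "L x y + L y x \<le> gain \<Delta> w ?f x y" if xy: "x \<in> {0..1}" "y \<in> {0..1}" for x y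
  proof -
    consider "x \<in> S" "y \<in> K1 \<union> K2" | "y \<in> S" "x \<in> K1 \<union> K2" | "x \<notin> S" "y \<notin> S"
      | "x \<in> S" "y \<notin> S" "y \<notin> K1 \<union> K2" | "y \<in> S" "x \<notin> S" "x \<notin> K1 \<union> K2" | "x \<in> S" "y \<in> S"
      by blast
    then show ?thesis
    proof cases
      case 1
      with dust_cluster[OF 1] S_disj L_outside[of y x] show ?thesis by force
    next
      case 2
      with dust_cluster[OF 2] S_disj L_outside[of x y] gain_sym[of x y] show ?thesis by force
    next
      case 3
      then show ?thesis using gain_lower[of x y] f_out xy L_outside by simp
    next
      case 4
      then show ?thesis using gain_lower[of x y] f_out[of y] xy L_outside[of y x] dust_other[of x y] by simp
    next
      case 5
      then show ?thesis using gain_lower[of x y] f_out[of x] xy L_outside[of x y] dust_other[of y x] by simp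
    next
      case 6
      then show ?thesis
        using gain_lower[of x y] dust_other[of x y] dust_other[of y x] xy S_disj[of x] S_disj[of y]
            by simp
    qed
  qed
  interpret pair_prob_space \<mu> \<mu> by (rule prob_unit_pair_prob_space[OF \<mu>])
  define \<Lambda> where "\<Lambda>
      = c * (measure \<mu> Sr * measure \<mu> K1) + c * (measure \<mu> Sl * measure \<mu> K2) - 2 * r * measure \<mu> S
        - measure \<mu> S * measure \<mu> ?D"
  have measU: "measure \<mu> U = 1" using M1.prob_space prob_unit_space[OF \<mu>] by (simp add: U_def)
  have intL: "integrable (\<mu> \<Otimes>\<^sub>M \<mu>) (\<lambda>z. L (fst z) (snd z))"
    unfolding L_def using sets U_sets
    by (intro Bochner_Integration.integrable_diff Bochner_Integration.integrable_add
        integrable_mult_right integrable_indicator_Times[OF \<mu>])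
  have L1: "(\<integral>z. L (fst z) (snd z) \<partial>(\<mu> \<Otimes>\<^sub>M \<mu>)) = \<Lambda>"
    unfolding L_def \<Lambda>_def
    using sets U_sets integrable_indicator_Times[OF \<mu>] integral_indicator_Times[OF \<mu>] measU by simp
  have swap: "(\<lambda>z. L (snd z) (fst z)) = (\<lambda>(x, y). (\<lambda>z. L (fst z) (snd z)) (y, x))"
    by auto
  have intL2: "integrable (\<mu> \<Otimes>\<^sub>M \<mu>) (\<lambda>z. L (snd z) (fst z))"
    unfolding swap by (rule integrable_product_swap[OF intL])
  have L2: "(\<integral>z. L (snd z) (fst z) \<partial>(\<mu> \<Otimes>\<^sub>M \<mu>)) = \<Lambda>"
    unfolding swap L1[symmetric] using intL by (intro integral_product_swap) simp
  have "(\<integral>z. L (fst z) (snd z) + L (snd z) (fst z) \<partial>(\<mu> \<Otimes>\<^sub>M \<mu>)) \<le> drift \<Delta> w ?f \<mu>"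
    unfolding drift_def
    using key intL intL2 integrable_gain[OF _ _ \<mu> observable_hump] w
    by (intro integral_mono) (auto simp: prob_unit_pair_space[OF \<mu>])
  then have "2 * \<Lambda> \<le> drift \<Delta> w ?f \<mu>" using intL intL2 L1 L2 by simp
  moreover have "0 \<le> \<Lambda>"
  proof -
    have "measure \<mu> S = measure \<mu> (Sr \<union> Sl)"
        by (rule arg_cong[where f = "measure \<mu>"]) (auto simp: set_defs)
    also have "\<dots> = measure \<mu> Sr + measure \<mu> Sl"
      using sets prob_unit_sets[OF \<mu>] by (intro M1.finite_measure_Union) (auto simp: set_defs)
    finally have S_split: "measure \<mu> S = measure \<mu> Sr + measure \<mu> Sl" .
    have "measure \<mu> Sr * a \<le> measure \<mu> Sr * measure \<mu> K1"
        "measure \<mu> Sl * a \<le> measure \<mu> Sl * measure \<mu> K2"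
      using C1 C2 by (auto simp: K1_def K2_def intro!: mult_left_mono)
    then have "c * (measure \<mu> Sr * a) \<le> c * (measure \<mu> Sr * measure \<mu> K1)"
        "c * (measure \<mu> Sl * a) \<le> c * (measure \<mu> Sl * measure \<mu> K2)"
      using c_pos by simp_all
    moreover have "measure \<mu> S * measure \<mu> ?D \<le> 2 * r * measure \<mu> S"
      using mult_left_mono[OF D measure_nonneg[of \<mu> S]] by (simp add: mult.commute)
    moreover have "c * (measure \<mu> Sr * a) + c * (measure \<mu> Sl * a) = (a * c) * measure \<mu> S"
      unfolding S_split by (simp add: algebra_simps)
    ultimately show ?thesis unfolding \<Lambda>_def ac by linarith
  qed
  ultimately show ?thesis by (simp add: A_def B_def)
qed

text \<open>
  The three facts that lead to the contradiction are: the dust vanishes from some time \<open>T\<close> on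
  (\<open>S_null\<close>); both inner sides of the gap then carry mass (\<open>K1_pos\<close>, \<open>K2_pos\<close>); and so dust is
  produced at a positive rate at every time after \<open>T\<close> (\<open>drift_pos\<close>).
\<close>
lemma atoms_not_at_threshold:
  fixes \<Delta> w :: real and \<alpha> x :: "nat \<Rightarrow> real"
  assumes sol: "is_solution \<Delta> w m0 m" and w: "0 < w" "w < 1" and \<Delta>: "0 < \<Delta>" "\<Delta> \<le> 1"
    and lim: "\<And>f. continuous_on {0..1} f \<Longrightarrow>
        ((\<lambda>t. \<integral>x. f x \<partial>m t) \<longlongrightarrow> (\<Sum>i\<in>I. \<alpha> i * f (x i))) at_top"
    and I: "finite I" "\<And>i. i \<in> I \<Longrightarrow> 0 < \<alpha> i" "(\<Sum>i\<in>I. \<alpha> i) = 1"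
    and sep: "\<And>i j. i \<in> I \<Longrightarrow> j \<in> I \<Longrightarrow> i \<noteq> j \<Longrightarrow> \<Delta> \<le> \<bar>x i - x j\<bar>"
    and ij: "i \<in> I" "j \<in> I"
  shows "x j \<noteq> x i + \<Delta>"
proof
  assume xj: "x j = x i + \<Delta>"
  define p where "p = x i"
  define a where "a = min (\<alpha> i) (\<alpha> j) / 2"
  have alpha_le: "\<alpha> i \<le> 1" using member_le_sum[of i I \<alpha>] I ij by (auto intro: less_imp_le)
  have a: "0 < a" "a \<le> 1" "a < \<alpha> i" "a < \<alpha> j" using I(2)[OF ij(1)] I(2)[OF ij(2)] alpha_le
      by (auto simp: a_def min_def)
  define r where "r = a * w * (1 - w) * \<Delta>\<^sup>2 / 16"
  have r_pos: "0 < r" using a w \<Delta> by (simp add: r_def)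
  have r_w: "2 * r < w * \<Delta>" "2 * r < (1 - w) * \<Delta>" "8 * r \<le> \<Delta>"
  proof -
    have b: "a * \<Delta> \<le> 1" using a \<Delta> mult_le_one[of a \<Delta>] by simp
    have b1: "a * \<Delta> * (1 - w) \<le> 1" "a * \<Delta> * w \<le> 1"
      using w a \<Delta> b mult_le_one[of "a * \<Delta>" "1 - w"] mult_le_one[of "a * \<Delta>" w] by auto
    have "(a * \<Delta> * (1 - w)) * (w * \<Delta>) \<le> 1 * (w * \<Delta>)" "(a * \<Delta> * w) * ((1 - w) * \<Delta>) \<le> 1 * ((1 - w) * \<Delta>)"
      using b1 w \<Delta> by (intro mult_right_mono; simp)+
    moreover have "16 * r = (a * \<Delta> * (1 - w)) * (w * \<Delta>)" "16 * r = (a * \<Delta> * w) * ((1 - w) * \<Delta>)"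
      by (simp_all add: r_def power2_eq_square)
    ultimately have rr: "16 * r \<le> w * \<Delta>" "16 * r \<le> (1 - w) * \<Delta>" by linarith+
    moreover have "0 < w * \<Delta>" "0 < (1 - w) * \<Delta>" using w \<Delta> by simp_all
    ultimately show "2 * r < w * \<Delta>" "2 * r < (1 - w) * \<Delta>" using r_pos by linarith+
    have "w * \<Delta> \<le> \<Delta>" using w \<Delta> by simp
    with rr r_pos show "8 * r \<le> \<Delta>" by linarith
  qed
  have other: "x k \<le> p - \<Delta> \<or> p + 2 * \<Delta> \<le> x k" if "k \<in> I" "k \<noteq> i" "k \<noteq> j" for k
    using sep[OF that(1) ij(1) that(2)] sep[OF that(1) ij(2) that(3)] \<Delta>
        by (auto simp: p_def xj abs_if split: if_splits)
  \<comment> \<open>Test functions are chosen to see at most one atom.\<close>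
  have single: "(\<Sum>k\<in>I. \<alpha> k * f (x k)) = \<alpha> l * f (x l)" if "l \<in> I" "\<And>k. k \<in> I \<Longrightarrow> k \<noteq> l \<Longrightarrow> f (x k) = 0"
    for f :: "real \<Rightarrow> real" and l
    using sum.mono_neutral_right[of I "{l}" "\<lambda>k. \<alpha> k * f (x k)"] I(1) that by auto
  have prob: "m t \<in> prob_unit" if "0 \<le> t" for t
    using sol that by (simp add: is_solution_def)
  have cluster: "\<forall>\<^sub>F t in at_top. a \<le> measure (m t) {y \<in> {0..1}. \<bar>y - x l\<bar> \<le> r}" if l: "l \<in> I"
      "a < \<alpha> l" for l
  proof -
    \<comment> \<open>A tent below the indicator of the cluster.\<close>
    define f where "f y = max 0 (1 - \<bar>y - x l\<bar> / r)" for y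
    have cont: "continuous_on {0..1} f" unfolding f_def using r_pos by (intro continuous_intros) auto
    have "(\<Sum>k\<in>I. \<alpha> k * f (x k)) = \<alpha> l * f (x l)"
    proof (rule single[OF l(1)])
      fix k assume "k \<in> I" "k \<noteq> l"
      then have "r \<le> \<bar>x k - x l\<bar>" using sep[of k l] l r_w r_pos by simp
      then show "f (x k) = 0" using r_pos by (simp add: f_def field_simps)
    qed
    then have "((\<lambda>t. \<integral>x. f x \<partial>m t) \<longlongrightarrow> \<alpha> l) at_top" using lim[OF cont] by (simp add: f_def)
    from order_tendstoD(1)[OF this l(2)] eventually_ge_at_top[of 0]
    show ?thesis
    proof eventually_elim
      case (elim t)
      have "(\<integral>x. f x \<partial>m t) \<le> measure (m t) {y \<in> {0..1}. \<bar>y - x l\<bar> \<le> r}"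
        using r_pos by (intro integral_le_measure prob elim observable_continuous cont)
            (auto simp: f_def field_simps)
      with elim show ?case by simp
    qed
  qed
  have dust: "\<forall>\<^sub>F t in at_top. measure (m t) {y \<in> {0..1}. r < \<bar>y - p\<bar> \<and> r < \<bar>y - (p + \<Delta>)\<bar>
      \<and> r < y - p + \<Delta> \<and> r < p + 2 * \<Delta> - y} \<le> 2 * r"
  proof -
    \<comment> \<open>Scaled distance to the points \<open>p\<close>, \<open>p + \<Delta>\<close>, \<open>p - \<Delta>\<close> and \<open>p + 2 \<Delta>\<close>, the last two of which bound
      the other atoms. It vanishes at all atoms and is at least 1 on the set to be estimated.\<close>
    define g where "g y = max 0 (min (min \<bar>y - p\<bar> \<bar>y - (p + \<Delta>)\<bar>) (min (y - p + \<Delta>) (p + 2 * \<Delta>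
        - y))) / r" for y
    have cont: "continuous_on {0..1} g" unfolding g_def using r_pos by (intro continuous_intros) auto
    have "g (x k) = 0" if "k \<in> I" for k
      using other[OF that] xj by (cases "k = i \<or> k = j") (auto simp: g_def p_def max_def min_def)
    then have "((\<lambda>t. \<integral>x. g x \<partial>m t) \<longlongrightarrow> 0) at_top" using lim[OF cont] by simp
    then have "\<forall>\<^sub>F t in at_top. (\<integral>x. g x \<partial>m t) < 2 * r"
      using r_pos by (intro order_tendstoD(2)) auto
    with eventually_ge_at_top[of 0] show ?thesis
    proof eventually_elim
      case (elim t)
      have "measure (m t) {y \<in> {0..1}. r < \<bar>y - p\<bar> \<and> r < \<bar>y - (p + \<Delta>)\<bar> \<and> r < y - p + \<Delta>
          \<and> r < p + 2 * \<Delta> - y} \<le> (\<integral>x. g x \<partial>m t)"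
        using r_pos by (intro measure_le_integral prob elim observable_continuous cont)
            (auto simp: g_def field_simps)
      with elim show ?case by simp
    qed
  qed
  let ?f = "hump (p + r) (p + \<Delta> - r)"
  have AB: "p + r < p + \<Delta> - r" using r_w r_pos by simp
  from cluster[OF ij(1) a(3)] cluster[OF ij(2) a(4)] dust eventually_ge_at_top[of 0]
  have "\<forall>\<^sub>F t in at_top. 0 \<le> t \<and> 0 \<le> drift \<Delta> w ?f (m t)"
  proof eventually_elim
    case (elim t)
    then show ?case
      using drift_hump_nonneg[OF prob[OF elim(4)] w \<Delta> a(1,2) r_def, of p] by (simp add: p_def xj)
  qed
  then obtain T where T: "\<And>t. T \<le> t \<Longrightarrow> 0 \<le> t \<and> 0 \<le> drift \<Delta> w ?f (m t)"
    unfolding eventually_at_top_linorder by blast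
  then have T0: "0 \<le> T" by blast
  have "?f (x k) = 0" if "k \<in> I" for k
    using other[OF that] xj r_pos \<Delta> AB by (cases "k = i \<or> k = j") (auto intro!: hump_eq_0 simp: p_def)
  then have lim0: "((\<lambda>t. \<integral>x. ?f x \<partial>m t) \<longlongrightarrow> 0) at_top"
    using lim[of ?f] unfolding hump_def by (simp add: continuous_intros)
  have f_zero: "(\<integral>x. ?f x \<partial>m t) = 0" if t: "T \<le> t" for t
  proof (rule antisym)
    show "(\<integral>x. ?f x \<partial>m t) \<le> 0"
    proof (rule tendsto_lowerbound[OF lim0])
      show "\<forall>\<^sub>F s in at_top. (\<integral>x. ?f x \<partial>m t) \<le> (\<integral>x. ?f x \<partial>m s)"
        using eventually_ge_at_top[of t]
        by eventually_elim
          (rule integral_mono_of_drift_nonneg[OF sol _ _ observable_hump], use w t T in auto)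
    qed simp
    show "0 \<le> (\<integral>x. ?f x \<partial>m t)" by (intro Bochner_Integration.integral_nonneg hump_nonneg)
  qed
  define S where "S = {y \<in> {0..1}. p + r < y \<and> y < p + \<Delta> - r}"
  have S_sets: "S \<in> sets unit_borel"
    unfolding S_def by (intro sets_unit_borel_Collect) measurable
  have S_null: "measure (m t) S = 0" if t: "T \<le> t" for t
  proof -
    note \<mu> = prob[OF conjunct1[OF T[OF t]]]
    interpret prob_space "m t" by (rule prob_unit_prob_space[OF \<mu>])
    have "AE y in m t. ?f y = 0"
      using f_zero[OF t] integrable_observable[OF \<mu> observable_hump] hump_nonneg
      by (subst (asm) integral_nonneg_eq_0_iff_AE) auto
    then have "AE y in m t. y \<notin> S"
    proof eventually_elim
      case (elim y)
      then show ?case using hump_pos_iff[OF AB, of y] by (auto simp: S_def)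
    qed
    then have "S \<in> null_sets (m t)"
      using S_sets prob_unit_sets[OF \<mu>] by (simp add: AE_iff_null_sets)
    then show ?thesis by (simp add: measure_def null_sets_def)
  qed
  have S_right: "{y \<in> {0..1}. r < 1 * (y - p) \<and> 1 * (y - p) < \<Delta> - r} = S"
    by (auto simp: S_def)
  have S_left: "{y \<in> {0..1}. r < -1 * (y - x j) \<and> -1 * (y - x j) < \<Delta> - r} = S"
    by (auto simp: S_def xj p_def)
  define K1 where "K1 = {y \<in> {0..1}. p \<le> y \<and> y \<le> p + r}"
  define K2 where "K2 = {y \<in> {0..1}. p + \<Delta> - r \<le> y \<and> y \<le> p + \<Delta>}"
  have "K1 \<in> sets unit_borel"
    unfolding K1_def by (intro sets_unit_borel_Collect) measurable
  moreover have "K2 \<in> sets unit_borel"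
    unfolding K2_def by (intro sets_unit_borel_Collect) measurable
  ultimately have K_sets: "K1 \<in> sets unit_borel" "K2 \<in> sets unit_borel" "{0..1} \<in> sets unit_borel"
    using unit_interval_sets by auto
  have lim_side: "((\<lambda>t. \<integral>y. max 0 (min (\<epsilon> + \<sigma> * (y - x l)) (\<Delta> - r - \<sigma> * (y
      - x l))) \<partial>m t) \<longlongrightarrow> \<alpha> l * \<epsilon>) at_top"
    if l: "l \<in> I" and \<sigma>: "\<sigma> = 1 \<or> \<sigma> = -1" and \<epsilon>: "0 < \<epsilon>" "\<epsilon> \<le> r" for \<sigma> \<epsilon> l
  proof -
    define f where "f y = max 0 (min (\<epsilon> + \<sigma> * (y - x l)) (\<Delta> - r - \<sigma> * (y - x l)))" for y
    have cont: "continuous_on {0..1} f" unfolding f_def by (intro continuous_intros)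
    have "(\<Sum>k\<in>I. \<alpha> k * f (x k)) = \<alpha> l * f (x l)"
    proof (rule single[OF l])
      fix k assume "k \<in> I" "k \<noteq> l"
      then have "\<Delta> \<le> \<bar>x k - x l\<bar>" using sep[of k l] l by simp
      then show "f (x k) = 0" using r_pos r_w \<epsilon> \<sigma> by (auto simp: f_def abs_if split: if_splits)
    qed
    moreover have "f (x l) = \<epsilon>" using \<epsilon> r_w r_pos by (simp add: f_def)
    ultimately show ?thesis using lim[OF cont] by (simp add: f_def)
  qed
  have K1_pos: "0 < measure (m t) K1" if t: "T \<le> t" for t
  proof -
    have "0 < measure (m t) {y \<in> {0..1}. 0 \<le> 1 * (y - p) \<and> 1 * (y - p) \<le> r}"
    proof (rule charged_inner_side[OF sol w _ r_pos _ r_w(1,2) T0 _ _ _ t])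
      show "0 < \<alpha> i" using I(2) ij by simp
      show "((\<lambda>t. \<integral>y. max 0 (min (\<epsilon> + 1 * (y - p)) (\<Delta> - r - 1 * (y - p))) \<partial>m t) \<longlongrightarrow> \<alpha> i * \<epsilon>) at_top"
        if "0 < \<epsilon>" "\<epsilon> \<le> r" for \<epsilon>
        using lim_side[OF ij(1) _ that, of 1] by (simp add: p_def)
    qed (use S_null r_w r_pos in \<open>simp_all only: S_right, simp_all\<close>)
    also have "{y \<in> {0..1}. 0 \<le> 1 * (y - p) \<and> 1 * (y - p) \<le> r} = K1" by (auto simp: K1_def)
    finally show ?thesis .
  qed
  have K2_pos: "0 < measure (m t) K2" if t: "T \<le> t" for t
  proof -
    have "0 < measure (m t) {y \<in> {0..1}. 0 \<le> -1 * (y - x j) \<and> -1 * (y - x j) \<le> r}"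
    proof (rule charged_inner_side[OF sol w _ r_pos _ r_w(1,2) T0 _ _ _ t])
      show "0 < \<alpha> j" using I(2) ij by simp
      show "((\<lambda>t. \<integral>y. max 0 (min (\<epsilon> + -1 * (y - x j)) (\<Delta> - r - -1 * (y - x j))) \<partial>m t) \<longlongrightarrow> \<alpha> j * \<epsilon>) at_top"
        if "0 < \<epsilon>" "\<epsilon> \<le> r" for \<epsilon>
        by (rule lim_side[OF ij(2) _ that]) simp
    qed (use S_null r_w r_pos in \<open>simp_all only: S_left, simp_all\<close>)
    also have "{y \<in> {0..1}. 0 \<le> -1 * (y - x j) \<and> -1 * (y - x j) \<le> r} = K2"
        by (auto simp: K2_def xj p_def)
    finally show ?thesis .
  qed
  \<comment> \<open>A lower bound for the weight of a jump between the inner sides: such a jump lands at distance at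
    least \<open>(1 - w) \<Delta> - 2 r\<close> from the left end of the gap and \<open>w \<Delta> - 2 r\<close> from the right end.\<close>
  define b where "b = ((1 - w) * \<Delta> - 2 * r) * (w * \<Delta> - 2 * r)"
  have b_pos: "0 < b" using r_w by (simp add: b_def)
  have f_le: "?f y \<le> 1" for y
  proof (cases "p + r < y \<and> y < p + \<Delta> - r")
    case True
    then have "(y - (p + r)) * (p + \<Delta> - r - y) \<le> 1"
      using r_pos \<Delta> by (intro mult_le_one) auto
    with True show ?thesis by (simp add: hump_eq)
  qed (use hump_eq_0[OF AB, of y] in simp)
  have cross: "b \<le> ?f (w * y + (1 - w) * z)" if y: "y \<in> K1" and z: "z \<in> K2" for y z
  proof -
    have "w * p \<le> w * y" "w * y \<le> w * (p + r)" "(1 - w) * (p + \<Delta> - r) \<le> (1 - w) * z"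
        "(1 - w) * z \<le> (1 - w) * (p + \<Delta>)"
      using y z w by (auto simp: K1_def K2_def intro!: mult_left_mono)
    moreover have "w * r \<le> r" "0 \<le> w * r" using w r_pos by simp_all
    ultimately have 1: "(1 - w) * \<Delta> - 2 * r \<le> w * y + (1 - w) * z - (p + r)"
      and 2: "w * \<Delta> - 2 * r \<le> p + \<Delta> - r - (w * y + (1 - w) * z)"
      by (simp_all add: algebra_simps)
    have "b \<le> (w * y + (1 - w) * z - (p + r)) * (p + \<Delta> - r - (w * y + (1 - w) * z))"
      unfolding b_def using 1 2 r_w by (intro mult_mono) auto
    then show ?thesis by (simp add: hump_def)
  qed
  have drift_pos: "0 < drift \<Delta> w ?f (m t)" if t: "T \<le> t" for t
  proof -
    note \<mu> = prob[OF conjunct1[OF T[OF t]]]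
    interpret pair_prob_space "m t" "m t" by (rule prob_unit_pair_prob_space[OF \<mu>])
    define L where "L z = b * (indicat_real K1 (fst z) * indicat_real K2 (snd z))
      - indicat_real S (fst z) * indicat_real {0..1} (snd z)
          - indicat_real {0..1} (fst z) * indicat_real S (snd z)" for z :: "real \<times> real"
    have "b * (indicat_real K1 y * indicat_real K2 z) - indicat_real S y * indicat_real {0..1} z
        - indicat_real {0..1} y * indicat_real S z
       \<le> gain \<Delta> w ?f y z" if yz: "y \<in> {0..1}" "z \<in> {0..1}" for y z
    proof (cases "y \<in> K1 \<and> z \<in> K2")
      case True
      then have "\<bar>y - z\<bar> \<le> \<Delta>" "?f y = 0" "?f z = 0"
        using r_w r_pos by (auto simp: K1_def K2_def intro!: hump_eq_0)
      moreover have "y \<notin> S" "z \<notin> S" using True by (auto simp: S_def K1_def K2_def)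
      ultimately show ?thesis
        using cross[of y z] True hump_nonneg[of "p + r" "p + \<Delta> - r" "w * z + (1 - w) * y"]
            by (simp add: gain_def)
    next
      case False
      have "?f y \<le> indicat_real S y" "?f z \<le> indicat_real S z"
        using f_le hump_eq_0[OF AB] yz by (auto simp: S_def indicator_def)
      then have "- indicat_real S y - indicat_real S z \<le> gain \<Delta> w ?f y z"
        using hump_nonneg[of "p + r" "p + \<Delta> - r" "w * z + (1 - w) * y"] hump_nonneg[of "p + r"
            "p + \<Delta> - r" "w * y + (1 - w) * z"]
        by (auto simp: gain_def indicator_def split: if_splits)
      with False yz show ?thesis by auto
    qed
    then have "(\<integral>z. L z \<partial>(m t \<Otimes>\<^sub>M m t)) \<le> drift \<Delta> w ?f (m t)"
      unfolding drift_def L_def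
      using integrable_gain[OF _ _ \<mu> observable_hump] integrable_indicator_Times[OF \<mu>] S_sets K_sets w
      by (intro integral_mono) (auto simp: prob_unit_pair_space[OF \<mu>] simp del: atLeastAtMost_iff)
    moreover have "(\<integral>z. L z \<partial>(m t \<Otimes>\<^sub>M m t)) = b * (measure (m t) K1 * measure (m t) K2)"
      unfolding L_def
      using integrable_indicator_Times[OF \<mu>] integral_indicator_Times[OF \<mu>] S_sets K_sets S_null[OF t] by simp
    moreover have "0 < b * (measure (m t) K1 * measure (m t) K2)"
      using b_pos K1_pos[OF t] K2_pos[OF t] by simp
    ultimately show ?thesis by linarith
  qed
  have "((\<lambda>t. drift \<Delta> w ?f (m t)) has_integral 0) {T..T + 1}"
    using has_integral_drift[OF sol _ _ observable_hump[of "p + r"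
        "p + \<Delta> - r"] T0, of "T + 1"] f_zero w by simp
  then show False
    using not_has_integral_0_of_pos[of T "T + 1" "\<lambda>t. drift \<Delta> w ?f (m t)"] drift_pos by simp
qed

section \<open>Finite sums of point masses\<close>

text \<open>
  Makes the change of variables formula available for integrals, and shows that the measures in
  question exist.
\<close>
lemma dirac_sum_eq_distr:
  assumes "\<And>i. i \<in> {1..n} \<Longrightarrow> 0 \<le> \<alpha> i" and "\<And>i. i \<in> {1..n} \<Longrightarrow> x i \<in> {0..1}"
  shows "is_dirac_sum n \<alpha> x \<nu> \<longleftrightarrow> \<nu> = distr (point_measure {1..n} (\<lambda>i. ennreal (\<alpha> i))) unit_borel x"
proof -
  let ?D = "distr (point_measure {1..n} (\<lambda>i. ennreal (\<alpha> i))) unit_borel x"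
  have x_meas: "x \<in> point_measure {1..n} (\<lambda>i. ennreal (\<alpha> i)) \<rightarrow>\<^sub>M unit_borel"
    using assms(2) by (auto simp: measurable_def space_point_measure sets_point_measure)
  have D: "emeasure ?D A = (\<Sum>i=1..n. ennreal (\<alpha> i) * emeasure (return unit_borel (x i)) A)"
    if A: "A \<in> sets unit_borel" for A
  proof -
    have "emeasure ?D A = emeasure (point_measure {1..n} (\<lambda>i. ennreal (\<alpha> i))) (x -` A \<inter> {1..n})"
      using emeasure_distr[OF x_meas A] by (simp add: space_point_measure)
    also have "\<dots> = (\<Sum>i\<in>x -` A \<inter> {1..n}. ennreal (\<alpha> i))"
      by (subst emeasure_point_measure_finite) auto
    also have "\<dots> = (\<Sum>i=1..n. ennreal (\<alpha> i) * indicator A (x i))"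
      by (intro sum.mono_neutral_cong_left) (auto simp: indicator_def)
    finally show ?thesis using A by simp
  qed
  show ?thesis
  proof
    assume \<nu>: "is_dirac_sum n \<alpha> x \<nu>"
    show "\<nu> = ?D"
      by (rule measure_eqI) (use \<nu> D in \<open>auto simp: is_dirac_sum_def\<close>)
  next
    assume "\<nu> = ?D"
    with D show "is_dirac_sum n \<alpha> x \<nu>" by (simp add: is_dirac_sum_def)
  qed
qed

lemma integral_dirac_sum:
  assumes "\<And>i. i \<in> {1..n} \<Longrightarrow> 0 \<le> \<alpha> i" and "\<And>i. i \<in> {1..n} \<Longrightarrow> x i \<in> {0..1}"
    and "is_dirac_sum n \<alpha> x \<nu>" and "g \<in> borel_measurable unit_borel"
  shows "(\<integral>z. g z \<partial>\<nu>) = (\<Sum>i=1..n. \<alpha> i * g (x i))"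
proof -
  have x_meas: "x \<in> point_measure {1..n} (\<lambda>i. ennreal (\<alpha> i)) \<rightarrow>\<^sub>M unit_borel"
    using assms(2) by (auto simp: measurable_def space_point_measure sets_point_measure)
  have "(\<integral>z. g z \<partial>\<nu>) = (\<integral>i. g (x i) \<partial>point_measure {1..n} (\<lambda>i. ennreal (\<alpha> i)))"
    using assms(3) dirac_sum_eq_distr[of n \<alpha> x \<nu>] assms(1,2) integral_distr[OF x_meas assms(4)] by simp
  also have "\<dots> = (\<Sum>i=1..n. \<alpha> i * g (x i))"
    using assms(1) by (subst lebesgue_integral_point_measure_finite) auto
  finally show ?thesis .
qed

text \<open>The limit lists its atoms in any order, a partial consensus in increasing order.\<close>
lemma sort_atoms:
  fixes x :: "nat \<Rightarrow> real"
  assumes sep: "\<And>i j. i \<in> {1..c} \<Longrightarrow> j \<in> {1..c} \<Longrightarrow> i \<noteq> j \<Longrightarrow> \<Delta> < \<bar>x i - x j\<bar>" and "0 \<le> \<Delta>"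
  obtains \<pi> where "bij_betw \<pi> {1..c} {1..c}"
    and "\<And>i. i \<in> {1..<c} \<Longrightarrow> (x \<circ> \<pi>) i + \<Delta> < (x \<circ> \<pi>) (i + 1)"
proof -
  have inj: "inj_on x {1..c}"
  proof (rule inj_onI)
    fix i j assume "i \<in> {1..c}" "j \<in> {1..c}" "x i = x j"
    then show "i = j" using sep[of i j] \<open>0 \<le> \<Delta>\<close> by fastforce
  qed
  define xs where "xs = sorted_list_of_set (x ` {1..c})"
  have xs: "distinct xs" "set xs = x ` {1..c}" "length xs = c" "sorted_wrt (<) xs"
    using card_image[OF inj] by (simp_all add: xs_def)
  define s where "s i = xs ! (i - 1)" for i
  have "bij_betw (\<lambda>i. i - 1) {1..c} {..<c}"
    by (rule bij_betw_byWitness[where f' = Suc]) auto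
  from bij_betw_trans[OF this bij_betw_nth[OF xs(1) _ refl, of "{..<c}"]]
  have s_bij: "bij_betw s {1..c} (x ` {1..c})"
    using xs by (simp add: s_def[abs_def] comp_def)
  have s_mono: "strict_mono_on {1..c} s"
    unfolding s_def using xs by (intro strict_mono_onI sorted_wrt_nth_less[OF xs(4)]) auto
  define \<pi> where "\<pi> = inv_into {1..c} x \<circ> s"
  have bij: "bij_betw \<pi> {1..c} {1..c}"
    unfolding \<pi>_def by (rule bij_betw_trans[OF s_bij]) (rule bij_betw_inv_into[OF inj_on_imp_bij_betw[OF inj]])
  have x\<pi>: "(x \<circ> \<pi>) i = s i" if "i \<in> {1..c}" for i
    using bij_betwE[OF s_bij] that by (auto simp: \<pi>_def f_inv_into_f)
  have mono: "strict_mono_on {1..c} (x \<circ> \<pi>)"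
    using s_mono x\<pi> unfolding strict_mono_on_def by metis
  have "(x \<circ> \<pi>) i + \<Delta> < (x \<circ> \<pi>) (i + 1)" if i: "i \<in> {1..<c}" for i
  proof -
    have ii: "i \<in> {1..c}" "i + 1 \<in> {1..c}" using i by auto
    then have "\<pi> i \<in> {1..c}" "\<pi> (i + 1) \<in> {1..c}" "\<pi> i \<noteq> \<pi> (i + 1)"
      using bij_betwE[OF bij] inj_onD[OF bij_betw_imp_inj_on[OF bij], of i "i + 1"] by auto
    then have "\<Delta> < \<bar>x (\<pi> i) - x (\<pi> (i + 1))\<bar>" by (rule sep)
    moreover have "(x \<circ> \<pi>) i < (x \<circ> \<pi>) (i + 1)"
      using strict_mono_onD[OF mono ii] by simp
    ultimately show ?thesis by simp
  qed
  with bij that show thesis by blast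
qed

text \<open>
  Replacing the two rightmost atoms by one at their barycentre keeps mass and mean, does not
  increase the integral of \<open>h\<close> by Jensen's inequality, and moves the last atom to the right, which
  only widens the gap to the previous one.
\<close>
lemma merge_atoms:
  fixes \<alpha> x :: "nat \<Rightarrow> real"
  assumes h: "convex_on {0..1} h" and \<Delta>: "0 \<le> \<Delta>" and n: "1 \<le> n" "n \<le> c"
    and "\<And>i. i \<in> {1..c} \<Longrightarrow> 0 < \<alpha> i" and "\<And>i. i \<in> {1..c} \<Longrightarrow> x i \<in> {0..1}"
    and "\<And>i. i \<in> {1..<c} \<Longrightarrow> x i + \<Delta> < x (i + 1)"
  shows "\<exists>\<alpha>' x'. (\<forall>i\<in>{1..n}. 0 < \<alpha>' i \<and> x' i \<in> {0..1}) \<and> (\<forall>i\<in>{1..<n}. x' i + \<Delta> < x' (i + 1))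
    \<and> (\<Sum>i=1..n. \<alpha>' i) = (\<Sum>i=1..c. \<alpha> i) \<and> (\<Sum>i=1..n. \<alpha>' i * x' i) = (\<Sum>i=1..c. \<alpha> i * x i)
    \<and> (\<Sum>i=1..n. \<alpha>' i * h (x' i)) \<le> (\<Sum>i=1..c. \<alpha> i * h (x i))"
  using n(2) assms(5-)
proof (induction c arbitrary: \<alpha> x rule: dec_induct)
  case base
  then show ?case by (intro exI[of _ \<alpha>] exI[of _ x]) auto
next
  case (step N)
  have N: "1 \<le> N" using n step by simp
  define a b where "a = \<alpha> N" and "b = \<alpha> (Suc N)"
  have ab: "0 < a" "0 < b" using step.prems(1) N by (auto simp: a_def b_def)
  define \<theta> where "\<theta> = b / (a + b)"
  have \<theta>: "0 < \<theta>" "\<theta> < 1" "(a + b) * \<theta> = b" "(a + b) * (1 - \<theta>) = a"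
    using ab by (auto simp: \<theta>_def field_simps)
  define z where "z = (1 - \<theta>) * x N + \<theta> * x (Suc N)"
  have xN: "x N \<in> {0..1}" "x (Suc N) \<in> {0..1}" "x N < x (Suc N)"
    using step.prems(2) step.prems(3)[of N] N \<Delta> by (auto simp: add_nonneg_pos)
  have z01: "z \<in> {0..1}"
    using convex_combination_in_unit[of "1 - \<theta>" "x N" "x (Suc N)"] \<theta> xN by (simp add: z_def)
  have "z - x N = \<theta> * (x (Suc N) - x N)" by (simp add: z_def algebra_simps)
  moreover have "0 < \<theta> * (x (Suc N) - x N)" using \<theta> xN by simp
  ultimately have zN: "x N < z" by simp
  have "(a + b) * z = ((a + b) * (1 - \<theta>)) * x N + ((a + b) * \<theta>) * x (Suc N)"
    by (simp add: z_def algebra_simps)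
  then have mean: "(a + b) * z = a * x N + b * x (Suc N)" using \<theta> by simp
  have "(a + b) * h z \<le> (a + b) * ((1 - \<theta>) * h (x N) + \<theta> * h (x (Suc N)))"
    using convex_onD[OF h, of \<theta> "x N" "x (Suc N)"] \<theta> xN ab unfolding z_def
    by (intro mult_left_mono) auto
  also have "\<dots> = ((a + b) * (1 - \<theta>)) * h (x N) + ((a + b) * \<theta>) * h (x (Suc N))"
    by (simp add: algebra_simps)
  finally have hz: "(a + b) * h z \<le> a * h (x N) + b * h (x (Suc N))" using \<theta> by simp
  define \<alpha>1 x1 where "\<alpha>1 = \<alpha>(N := a + b)" and "x1 = x(N := z)"
  have split: "(\<Sum>i=1..N. F i) = (\<Sum>i=1..N-1. F i) + F N" for F :: "nat \<Rightarrow> real"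
    using N by (cases N) auto
  have sum1: "(\<Sum>i=1..N. \<alpha>1 i * F (x1 i)) = (\<Sum>i=1..N-1. \<alpha> i * F (x i)) + (a + b) * F z"
      for F :: "real \<Rightarrow> real"
    unfolding split using N by (auto simp: \<alpha>1_def x1_def intro!: sum.cong)
  have sum2: "(\<Sum>i=1..Suc N. \<alpha> i * F (x i))
      = (\<Sum>i=1..N-1. \<alpha> i * F (x i)) + a * F (x N) + b * F (x (Suc N))"
    for F :: "real \<Rightarrow> real"
    using split[of "\<lambda>i. \<alpha> i * F (x i)"] by (simp add: a_def b_def)
  have pos1: "0 < \<alpha>1 i" "x1 i \<in> {0..1}" if "i \<in> {1..N}" for i
    using that step.prems(1,2)[of i] ab z01 by (auto simp: \<alpha>1_def x1_def)
  have sep1: "x1 i + \<Delta> < x1 (i + 1)" if "i \<in> {1..<N}" for i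
    using step.prems(3)[of i] that zN by (cases "i + 1 = N") (auto simp: x1_def)
  from step.IH[of \<alpha>1 x1, OF pos1 sep1] obtain \<alpha>' x' where IH:
    "\<forall>i\<in>{1..n}. 0 < \<alpha>' i \<and> x' i \<in> {0..1}" "\<forall>i\<in>{1..<n}. x' i + \<Delta> < x' (i + 1)"
    "(\<Sum>i=1..n. \<alpha>' i) = (\<Sum>i=1..N. \<alpha>1 i)" "(\<Sum>i=1..n. \<alpha>' i * x' i) = (\<Sum>i=1..N. \<alpha>1 i * x1 i)"
    "(\<Sum>i=1..n. \<alpha>' i * h (x' i)) \<le> (\<Sum>i=1..N. \<alpha>1 i * h (x1 i))"
    by blast
  have "(\<Sum>i=1..N. \<alpha>1 i) = (\<Sum>i=1..Suc N. \<alpha> i)"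
    using sum1[of "\<lambda>_. 1"] sum2[of "\<lambda>_. 1"] by simp
  moreover have "(\<Sum>i=1..N. \<alpha>1 i * x1 i) = (\<Sum>i=1..Suc N. \<alpha> i * x i)"
    using sum1[of "\<lambda>x. x"] sum2[of "\<lambda>x. x"] mean by simp
  moreover have "(\<Sum>i=1..N. \<alpha>1 i * h (x1 i)) \<le> (\<Sum>i=1..Suc N. \<alpha> i * h (x i))"
    using sum1[of h] sum2[of h] hz by simp
  ultimately show ?case using IH by (intro exI[of _ \<alpha>'] exI[of _ x']) auto
qed

lemma strict_mono_on_of_gaps:
  fixes x :: "nat \<Rightarrow> real"
  assumes "\<And>i. i \<in> {1..<n} \<Longrightarrow> x i + \<Delta> < x (i + 1)" and "0 \<le> \<Delta>"
  shows "strict_mono_on {1..n} x"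
proof (rule strict_mono_onI)
  fix i j assume i: "i \<in> {1..n}" "j \<in> {1..n}" "i < j"
  have "Suc i \<le> k \<Longrightarrow> k \<le> n \<Longrightarrow> x i < x k" for k
  proof (induction k rule: dec_induct)
    case base
    then show ?case using assms(1)[of i] assms(2) i by simp
  next
    case (step k)
    then show ?case using assms(1)[of k] assms(2) i by simp
  qed
  then show "x i < x j" using i by simp
qed

section \<open>The limit\<close>
lemma weak_limit_dirac_sum:
  assumes lim: "weak_limit m \<nu>" and \<nu>: "is_dirac_sum c \<alpha> x \<nu>"
    and pos: "\<And>i. i \<in> {1..c} \<Longrightarrow> 0 < \<alpha> i \<and> x i \<in> {0..1}"
  shows "(\<Sum>i=1..c. \<alpha> i) = 1"
    and "\<And>g. continuous_on {0..1} g \<Longrightarrow>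
      ((\<lambda>t. \<integral>z. g z \<partial>m t) \<longlongrightarrow> (\<Sum>i=1..c. \<alpha> i * g (x i))) at_top"
proof -
  have int: "(\<integral>z. g z \<partial>\<nu>) = (\<Sum>i=1..c. \<alpha> i * g (x i))" if "continuous_on {0..1} g"
    for g :: "real \<Rightarrow> real"
    using integral_dirac_sum[OF _ _ \<nu>, of g] observable_continuous[OF that] pos
    by (simp add: observable_def less_imp_le)
  have "prob_space \<nu>" using lim by (simp add: weak_limit_def prob_unit_def)
  then show "(\<Sum>i=1..c. \<alpha> i) = 1"
    using int[of "\<lambda>_. 1"] by (simp add: prob_space.prob_space)
  show "((\<lambda>t. \<integral>z. g z \<partial>m t) \<longlongrightarrow> (\<Sum>i=1..c. \<alpha> i * g (x i))) at_top"
    if "continuous_on {0..1} g" for g :: "real \<Rightarrow> real"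
    using lim that unfolding weak_limit_def int[OF that, symmetric] by blast
qed

lemma limit_atoms_strictly_separated:
  fixes \<Delta> w :: real and \<alpha> x :: "nat \<Rightarrow> real"
  assumes sol: "is_solution \<Delta> w m0 m" and w: "0 < w" "w < 1" and \<Delta>: "0 < \<Delta>" "\<Delta> \<le> 1"
    and lim: "weak_limit m \<nu>" and \<nu>: "is_dirac_sum c \<alpha> x \<nu>"
    and pos: "\<And>i. i \<in> {1..c} \<Longrightarrow> 0 < \<alpha> i \<and> x i \<in> {0..1}"
    and sep: "\<And>i j. i \<in> {1..c} \<Longrightarrow> j \<in> {1..c} \<Longrightarrow> i \<noteq> j \<Longrightarrow> \<Delta> \<le> \<bar>x i - x j\<bar>"
    and ij: "i \<in> {1..c}" "j \<in> {1..c}" "i \<noteq> j"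
  shows "\<Delta> < \<bar>x i - x j\<bar>"
proof -
  note ne = atoms_not_at_threshold[OF sol w \<Delta> weak_limit_dirac_sum(2)[OF lim \<nu> pos]
      finite_atLeastAtMost _ weak_limit_dirac_sum(1)[OF lim \<nu> pos] sep]
  have "x j \<noteq> x i + \<Delta>" by (rule ne) (use pos ij in auto)
  moreover have "x i \<noteq> x j + \<Delta>" by (rule ne) (use pos ij in auto)
  ultimately show ?thesis using sep[OF ij] by (auto simp: abs_if split: if_splits)
qed

theorem theorem5p2:
  fixes \<Delta> w q \<mu>0 :: real and n c :: nat and h :: "real \<Rightarrow> real"
    and m0 m_inf :: "real measure" and m :: "real \<Rightarrow> real measure"
  assumes "0 < \<Delta>" "\<Delta> \<le> 1" and "0 < w" "w < 1"
    and "m0 \<in> prob_unit"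
    and "is_solution \<Delta> w m0 m"
    and "\<mu>0 = (\<integral>x. x \<partial>m0)"
    and "weak_limit m m_inf" and "limit_consensus \<Delta> c m_inf"
    and "2 \<le> n"
    and "convex_on {0..1} h" and "continuous_on {0..1} h" and "\<forall>x\<in>{0..1}. 0 \<le> h x"
    and "0 \<le> q" and "q \<in> Q_set \<Delta> n \<mu>0 h"
    and "(\<integral>x. h x \<partial>m0) \<le> q"
  shows "c \<le> n - 1"
proof (rule ccontr)
  assume "\<not> c \<le> n - 1"
  then have nc: "1 \<le> n" "n \<le> c" using \<open>2 \<le> n\<close> by auto
  note \<Delta> = \<open>0 < \<Delta>\<close> \<open>\<Delta> \<le> 1\<close> and w = \<open>0 < w\<close> \<open>w < 1\<close> and sol = \<open>is_solution \<Delta> w m0 m\<close>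
    and lim = \<open>weak_limit m m_inf\<close> and h = \<open>convex_on {0..1} h\<close> \<open>continuous_on {0..1} h\<close>
  obtain \<alpha> x where pos: "\<And>i. i \<in> {1..c} \<Longrightarrow> 0 < \<alpha> i \<and> x i \<in> {0..1}"
    and sep: "\<And>i j. i \<in> {1..c} \<Longrightarrow> j \<in> {1..c} \<Longrightarrow> i \<noteq> j \<Longrightarrow> \<Delta> \<le> \<bar>x i - x j\<bar>"
    and dirac: "is_dirac_sum c \<alpha> x m_inf"
    using \<open>limit_consensus \<Delta> c m_inf\<close> unfolding limit_consensus_def by metis
  note total = weak_limit_dirac_sum(1)[OF lim dirac pos]
  have convex_bound: "(\<Sum>i=1..c. \<alpha> i * g (x i)) \<le> (\<integral>z. g z \<partial>m0)"
    if g: "convex_on {0..1} g" "continuous_on {0..1} g" for g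
  proof -
    have "((\<lambda>t. \<integral>z. g z \<partial>m t) \<longlongrightarrow> (\<Sum>i=1..c. \<alpha> i * g (x i))) at_top"
      by (rule weak_limit_dirac_sum(2)[OF lim dirac pos g(2)])
    then show ?thesis
    proof (rule tendsto_upperbound)
      show "\<forall>\<^sub>F t in at_top. (\<integral>z. g z \<partial>m t) \<le> (\<integral>z. g z \<partial>m0)"
        using eventually_ge_at_top[of 0]
        by eventually_elim (rule integral_convex_le_initial[OF sol _ _ g], use w in auto)
    qed (rule trivial_limit_at_top_linorder)
  qed
  have mean: "(\<Sum>i=1..c. \<alpha> i * x i) = \<mu>0"
  proof (rule antisym)
    show "(\<Sum>i=1..c. \<alpha> i * x i) \<le> \<mu>0"
      using convex_bound[of "\<lambda>x. x"] \<open>\<mu>0 = _\<close> by (simp add: convex_on_def)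
    show "\<mu>0 \<le> (\<Sum>i=1..c. \<alpha> i * x i)"
      using convex_bound[of "\<lambda>x. - x"] \<open>\<mu>0 = _\<close>
      by (simp add: convex_on_def continuous_on_minus sum_negf)
  qed
  have strict: "\<Delta> < \<bar>x i - x j\<bar>" if "i \<in> {1..c}" "j \<in> {1..c}" "i \<noteq> j" for i j
    by (rule limit_atoms_strictly_separated[OF sol w \<Delta> lim dirac pos sep that])
  obtain \<pi> where \<pi>: "bij_betw \<pi> {1..c} {1..c}"
    and gaps: "\<And>i. i \<in> {1..<c} \<Longrightarrow> (x \<circ> \<pi>) i + \<Delta> < (x \<circ> \<pi>) (i + 1)"
    using sort_atoms[of c \<Delta> x] strict \<Delta> by (metis less_imp_le)
  have reorder: "(\<Sum>i=1..c. (\<alpha> \<circ> \<pi>) i * g ((x \<circ> \<pi>) i)) = (\<Sum>i=1..c. \<alpha> i * g (x i))" for g :: "real \<Rightarrow> real"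
    using sum.reindex_bij_betw[OF \<pi>, of "\<lambda>i. \<alpha> i * g (x i)"] by simp
  have pos\<pi>: "0 < (\<alpha> \<circ> \<pi>) i" "(x \<circ> \<pi>) i \<in> {0..1}" if "i \<in> {1..c}" for i
    using pos[of "\<pi> i"] bij_betwE[OF \<pi>] that by auto
  obtain \<beta> y where y: "\<forall>i\<in>{1..n}. 0 < \<beta> i \<and> y i \<in> {0..1}" "\<forall>i\<in>{1..<n}. y i + \<Delta> < y (i + 1)"
    and sums: "(\<Sum>i=1..n. \<beta> i) = (\<Sum>i=1..c. (\<alpha> \<circ> \<pi>) i)"
      "(\<Sum>i=1..n. \<beta> i * y i) = (\<Sum>i=1..c. (\<alpha> \<circ> \<pi>) i * (x \<circ> \<pi>) i)"
      "(\<Sum>i=1..n. \<beta> i * h (y i)) \<le> (\<Sum>i=1..c. (\<alpha> \<circ> \<pi>) i * h ((x \<circ> \<pi>) i))"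
    using merge_atoms[OF h(1) less_imp_le[OF \<Delta>(1)] nc, of "\<alpha> \<circ> \<pi>" "x \<circ> \<pi>", OF pos\<pi> gaps] by blast
  define \<nu> where "\<nu> = distr (point_measure {1..n} (\<lambda>i. ennreal (\<beta> i))) unit_borel y"
  have \<nu>: "is_dirac_sum n \<beta> y \<nu>"
    using dirac_sum_eq_distr[of n \<beta> y \<nu>] y by (simp add: \<nu>_def less_imp_le)
  have "strict_mono_on {1..n} y"
    by (rule strict_mono_on_of_gaps[of n y \<Delta>]) (use y \<Delta> in auto)
  moreover have "(\<Sum>i=1..n. \<beta> i) = 1" using sums(1) total reorder[of "\<lambda>_. 1"] by simp
  moreover have "(\<Sum>i=1..n. \<beta> i * y i) = \<mu>0" using sums(2) mean reorder[of "\<lambda>x. x"] by simp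
  ultimately have "\<nu> \<in> partial_consensus \<Delta> n \<mu>0"
    unfolding partial_consensus_def using y \<nu> by blast
  then have "q < (\<integral>z. h z \<partial>\<nu>)"
    using \<open>q \<in> Q_set \<Delta> n \<mu>0 h\<close> by (simp add: Q_set_def)
  also have "\<dots> = (\<Sum>i=1..n. \<beta> i * h (y i))"
    using integral_dirac_sum[OF _ _ \<nu>, of h] observable_continuous[OF h(2)] y
    by (simp add: observable_def less_imp_le)
  also have "\<dots> \<le> (\<integral>z. h z \<partial>m0)"
    using sums(3) reorder[of h] convex_bound[OF h] by linarith
  also have "\<dots> \<le> q" by fact
  finally show False by simp
qed

end
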